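(* Let $\mathcal H$ be a finite-dimensional Hilbert space and let $R$ be a non-empty set of density operators on $\mathcal H$ such that only countably many of the sets $R_P=\{\rho\in R:\rho^0=P\}$, $P$ a projection on $\mathcal H$, are non-empty. For every $n\in\mathbb N$ let $S_n$ be a non-empty set of density operators on $\mathcal H^{\otimes n}$, and let $H_1:(S_n)_{n\in\mathbb N}$. Then there exists a countable max-relative entropy dense set $\tilde R\subseteq R$ such that for every $r>0$, $$\inf_{r'>r}\,\sup_{\rho\in\tilde R}\,\mathrm{sc}_{r'}(\rho\|H_1)\ \ge\ \mathrm{sc}_r^{\{0\}}(R\|H_1)\ \ge\ \sup_{\rho\in R}\mathrm{sc}_r(\rho\|H_1).$$
   Context: $\rho^0$ denotes the support projection of $\rho$. $\tilde R\subseteq R$ is max-relative entropy dense in $R$ if for every $\rho\in R$ and $\varepsilon>0$ there is $\tilde\rho\in\tilde R$ with $D_\infty^*(\tilde\rho\|\rho)<\varepsilon$, where $D_\infty^*(\rho\|\sigma)=\inf\{\lambda\in\mathbb R:\rho\le e^\lambda\sigma\}$. A test is an operator $T_n$ on $\mathcal H^{\otimes n}$ with $0\le T_n\le I$; $\beta_n(T_n)=\sup_{\sigma\in S_n}\operatorname{Tr}\sigma T_n$; $\log$ is natural, $-\log0=+\infty$. For a density operator $\rho$ on $\mathcal H$ (i.i.d. null hypothesis $(\rho^{\otimes n})_n$), $$\mathrm{sc}_r(\rho\|H_1)=\inf\Big\{\limsup_{n}-\tfrac1n\log\operatorname{Tr}\rho^{\otimes n}T_n:\ \liminf_{n}-\tfrac1n\log\beta_n(T_n)\ge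 r\Big\},$$ the infimum being over all test sequences satisfying the condition. $\mathrm{sc}_r^{\{0\}}(R\|H_1)$ is the infimum of $\sup_{\rho\in R}\limsup_n-\frac1n\log\operatorname{Tr}\rho^{\otimes n}T_n$ over all test sequences with $\liminf_n-\frac1n\log\beta_n(T_n)\ge r$. *)

theory Defs
  imports
    "Jordan_Normal_Form.Schur_Decomposition"
    "HOL-Library.Extended_Real"
    "HOL-Library.Countable_Set"
begin

text \<open>
  A finite-dimensional Hilbert space is taken to be \<open>\<complex>\<^sup>d\<close>, operators on it are complex
  \<open>d \<times> d\<close> matrices, and the \<open>n\<close>-fold tensor power of the space is \<open>\<complex>\<close> to the power \<open>d ^ n\<close>,
  operators on it being tensored by the Kronecker product.
\<close>

definition mat_trace :: "complex mat \<Rightarrow> complex" where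
  "mat_trace A = (\<Sum>i<dim_row A. A $$ (i, i))"

definition tensor_mat :: "complex mat \<Rightarrow> complex mat \<Rightarrow> complex mat" where
  "tensor_mat A B = mat (dim_row A * dim_row B) (dim_col A * dim_col B)
     (\<lambda>(i, j). A $$ (i div dim_row B, j div dim_col B) * B $$ (i mod dim_row B, j mod dim_col B))"

primrec tensor_pow :: "complex mat \<Rightarrow> nat \<Rightarrow> complex mat" where
  "tensor_pow A 0 = 1\<^sub>m 1"
| "tensor_pow A (Suc n) = tensor_mat A (tensor_pow A n)"

text \<open>
  In the order on \<^typ>\<open>complex\<close>, \<open>0 \<le> z\<close> says that \<open>z\<close> is real and non-negative, so the
  condition below includes self-adjointness. The library order on \<^typ>\<open>complex mat\<close> is
  entrywise and is not used; \<open>op_le n A B\<close> is the operator order.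
\<close>

definition pos_op :: "nat \<Rightarrow> complex mat \<Rightarrow> bool" where
  "pos_op n A \<longleftrightarrow> A \<in> carrier_mat n n \<and> (\<forall>v \<in> carrier_vec n. 0 \<le> (A *\<^sub>v v) \<bullet>c v)"

definition op_le :: "nat \<Rightarrow> complex mat \<Rightarrow> complex mat \<Rightarrow> bool" where
  "op_le n A B \<longleftrightarrow> A \<in> carrier_mat n n \<and> B \<in> carrier_mat n n \<and> pos_op n (B - A)"

definition density_op :: "nat \<Rightarrow> complex mat \<Rightarrow> bool" where
  "density_op n \<rho> \<longleftrightarrow> pos_op n \<rho> \<and> mat_trace \<rho> = 1"

definition projection_op :: "nat \<Rightarrow> complex mat \<Rightarrow> bool" where
  "projection_op n P \<longleftrightarrow> P \<in> carrier_mat n n \<and> mat_adjoint P = P \<and> P * P = P"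

text \<open>The support of a positive operator is its range, the orthogonal complement of its kernel.\<close>

definition support_proj :: "nat \<Rightarrow> complex mat \<Rightarrow> complex mat" where
  "support_proj n \<rho> = (THE P. projection_op n P \<and>
     (\<lambda>v. P *\<^sub>v v) ` carrier_vec n = (\<lambda>v. \<rho> *\<^sub>v v) ` carrier_vec n)"

text \<open>The infimum is taken in \<^typ>\<open>ereal\<close>, so it is \<open>\<infinity>\<close> if no \<open>\<lambda>\<close> qualifies.\<close>

definition D_max :: "nat \<Rightarrow> complex mat \<Rightarrow> complex mat \<Rightarrow> ereal" where
  "D_max d \<rho> \<sigma> = Inf (ereal ` {l :: real. op_le d \<rho> (complex_of_real (exp l) \<cdot>\<^sub>m \<sigma>)})"

definition max_rel_entropy_dense :: "nat \<Rightarrow> complex mat set \<Rightarrow> complex mat set \<Rightarrow> bool" where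
  "max_rel_entropy_dense d R' R \<longleftrightarrow>
     R' \<subseteq> R \<and> (\<forall>\<rho> \<in> R. \<forall>\<epsilon> :: real. \<epsilon> > 0 \<longrightarrow> (\<exists>\<rho>' \<in> R'. D_max d \<rho>' \<rho> < ereal \<epsilon>))"

definition is_test :: "nat \<Rightarrow> nat \<Rightarrow> complex mat \<Rightarrow> bool" where
  "is_test d n T \<longleftrightarrow> op_le (d ^ n) (0\<^sub>m (d ^ n) (d ^ n)) T \<and> op_le (d ^ n) T (1\<^sub>m (d ^ n))"

text \<open>
  For states \<open>\<sigma>\<close> and tests \<open>T\<close> the trace of \<open>\<sigma> * T\<close> lies in the real interval \<open>[0, 1]\<close>, so taking
  the real part loses nothing and the real supremum below is that of a bounded set.
\<close>

definition accept_prob :: "complex mat \<Rightarrow> complex mat \<Rightarrow> real" where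
  "accept_prob \<sigma> T = Re (mat_trace (\<sigma> * T))"

definition beta_err :: "complex mat set \<Rightarrow> complex mat \<Rightarrow> real" where
  "beta_err S T = (SUP \<sigma> \<in> S. accept_prob \<sigma> T)"

definition neg_log :: "real \<Rightarrow> ereal" where
  "neg_log x = (if x = 0 then \<infinity> else ereal (- ln x))"

definition exp_rate :: "(nat \<Rightarrow> real) \<Rightarrow> nat \<Rightarrow> ereal" where
  "exp_rate p n = neg_log (p n) / ereal (real n)"

text \<open>
  Sequences are indexed by \<open>n \<ge> 1\<close>; the values at \<open>n = 0\<close> are unconstrained and have no influence
  on the limits.
\<close>

definition admissible_tests ::
  "nat \<Rightarrow> (nat \<Rightarrow> complex mat set) \<Rightarrow> real \<Rightarrow> (nat \<Rightarrow> complex mat) set" where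
  "admissible_tests d S r =
     {T. (\<forall>n \<ge> 1. is_test d n (T n)) \<and>
         liminf (exp_rate (\<lambda>n. beta_err (S n) (T n))) \<ge> ereal r}"

definition success_rate :: "complex mat \<Rightarrow> (nat \<Rightarrow> complex mat) \<Rightarrow> ereal" where
  "success_rate \<rho> T = limsup (exp_rate (\<lambda>n. accept_prob (tensor_pow \<rho> n) (T n)))"

definition sc :: "nat \<Rightarrow> (nat \<Rightarrow> complex mat set) \<Rightarrow> real \<Rightarrow> complex mat \<Rightarrow> ereal" where
  "sc d S r \<rho> = (INF T \<in> admissible_tests d S r. success_rate \<rho> T)"

definition sc0 :: "nat \<Rightarrow> (nat \<Rightarrow> complex mat set) \<Rightarrow> real \<Rightarrow> complex mat set \<Rightarrow> ereal" where
  "sc0 d S r R = (INF T \<in> admissible_tests d S r. SUP \<rho> \<in> R. success_rate \<rho> T)"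

end

theory Submission
  imports
    "HOL-Analysis.Extended_Real_Limits"
    "HOL-Analysis.Function_Metric"
    Defs
begin

text \<open>
  If \<open>\<rho>\<close> and \<open>\<rho>'\<close> have the same support \<open>P\<close>, then \<open>P \<le> C \<rho>\<close> for a constant \<open>C\<close> depending on \<open>\<rho>\<close>, so
  \<open>\<rho>' \<le> (1 + \<epsilon>) \<rho>\<close> as soon as \<open>\<rho>'\<close> is close enough to \<open>\<rho>\<close>. Hence a countable dense subset of each of
  the countably many \<open>R\<^sub>P\<close> gives a countable max-relative entropy dense set \<open>R'\<close>. Choosing a test
  sequence of rate \<open>r' > r\<close> for each member of \<open>R'\<close> and averaging at stage \<open>n\<close> over at most \<open>n\<close> of them
  costs only a factor \<open>1 / n\<close> in the success probabilities, so a single sequence of rate \<open>r\<close> serves all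
  of \<open>R'\<close>. It serves \<open>R\<close> as well, because \<open>\<rho>' \<le> exp \<epsilon> \<rho>\<close> passes to tensor powers with constant
  \<open>exp (n \<epsilon>)\<close> and so changes the exponents by at most \<open>\<epsilon>\<close>.
\<close>

subsection \<open>Positive operators\<close>

text \<open>This is the form <Av, v> with matrices and vectors read as functions. Only indices below
  \<open>n\<close> count, so entries can be altered without any carrier condition.\<close>

definition quad_form :: "nat \<Rightarrow> (nat \<Rightarrow> nat \<Rightarrow> complex) \<Rightarrow> (nat \<Rightarrow> complex) \<Rightarrow> complex" where
  "quad_form n A v = (\<Sum>i<n. \<Sum>j<n. A i j * v j * cnj (v i))"

text \<open>Expansion of the form at v + t e_k. It serves twice: for test vectors with two non-zero
  entries, and for completing the square.\<close>

lemma quad_form_add_unit: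
  assumes "k < n"
  shows "quad_form n A (\<lambda>i. v i + (if i = k then t else 0))
    = quad_form n A v + t * (\<Sum>i<n. A i k * cnj (v i)) + cnj t * (\<Sum>j<n. A k j * v j)
      + t * cnj t * A k k"
proof -
  have row: "(\<Sum>j<n. A i j * (v j + (if j = k then t else 0))) = (\<Sum>j<n. A i j * v j) + A i k * t" for i
    using assms by (simp add: distrib_left sum.distrib if_distrib[of "times _"] cong: if_cong)
  have "quad_form n A (\<lambda>i. v i + (if i = k then t else 0))
    = (\<Sum>i<n. (\<Sum>j<n. A i j * (v j + (if j = k then t else 0))) * cnj (v i + (if i = k then t else 0)))"
    unfolding quad_form_def sum_distrib_right ..
  also have "\<dots> = (\<Sum>i<n. ((\<Sum>j<n. A i j * v j) + A i k * t) * cnj (v i)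
      + (if i = k then ((\<Sum>j<n. A i j * v j) + A i k * t) * cnj t else 0))"
    unfolding row by (intro sum.cong refl) (simp add: distrib_left)
  also have "\<dots> = (\<Sum>i<n. (\<Sum>j<n. A i j * v j) * cnj (v i)) + (\<Sum>i<n. t * (A i k * cnj (v i)))
      + ((\<Sum>j<n. A k j * v j) + A k k * t) * cnj t"
    using assms by (simp add: sum.distrib distrib_right) (simp add: mult_ac)
  finally show ?thesis
    unfolding quad_form_def sum_distrib_left sum_distrib_right by (simp add: algebra_simps sum_distrib_left sum_distrib_right)
qed

text \<open>The vector is e_i + t e_k. The case \<open>i = k\<close> is allowed; with
  \<open>t = 0\<close> it isolates the diagonal entry.\<close>

lemma quad_form_pair:
  assumes "i < n" "k < n"
  shows "quad_form n A (\<lambda>j. (if j = i then 1 else 0) + (if j = k then t else 0))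
    = A i i + t * A i k + cnj t * A k i + t * cnj t * A k k"
proof -
  have "quad_form n A (\<lambda>j. if j = i then 1 else 0) = A i i"
    using quad_form_add_unit[OF assms(1), of A "\<lambda>_. 0" 1] by (simp add: quad_form_def)
  moreover have "(\<Sum>j<n. A j k * cnj (if j = i then 1 else 0)) = A i k"
    using assms by (simp add: if_distrib[of cnj] if_distrib[of "times _"] cong: if_cong)
  moreover have "(\<Sum>j<n. A k j * (if j = i then 1 else 0)) = A k i"
    using assms by (simp add: if_distrib[of "times _"] cong: if_cong)
  ultimately show ?thesis by (simp only: quad_form_add_unit[OF assms(2)])
qed

lemma quad_form_nonneg_diag:
  assumes "\<And>v. 0 \<le> quad_form n A v" "i < n"
  shows "0 \<le> A i i"
  using assms(1)[of "\<lambda>j. (if j = i then 1 else 0) + (if j = i then 0 else 0)"]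
    quad_form_pair[OF assms(2,2), of A 0] by simp

lemma quad_form_nonneg_hermitian:
  assumes "\<And>v. 0 \<le> quad_form n A v" "i < n" "k < n"
  shows "A k i = cnj (A i k)"
proof -
  have "0 \<le> A i i + t * A i k + cnj t * A k i + t * cnj t * A k k" for t
    using assms(1)[of "\<lambda>j. (if j = i then 1 else 0) + (if j = k then t else 0)"]
    by (simp only: quad_form_pair[OF assms(2,3)])
  \<comment> \<open>All values are real. With \<open>t = 1\<close> the imaginary parts of
    \<open>A i k\<close> and \<open>A k i\<close> cancel; with \<open>t = \<i>\<close> their real
    parts agree.\<close>
  from this[of 1] this[of \<i>] show ?thesis
    using quad_form_nonneg_diag[OF assms(1)] assms(2,3)
    by (auto simp: less_eq_complex_def complex_eq_iff)
qed

text \<open>If \<open>A k k\<close> vanishes, the form at e_i + t e_k has no quadratic term in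
  \<open>t\<close>, so it is unbounded below unless the linear term vanishes too.\<close>

lemma quad_form_nonneg_zero_diag:
  assumes "\<And>v. 0 \<le> quad_form n A v" "i < n" "k < n" "A k k = 0"
  shows "A i k = 0"
proof (rule ccontr)
  assume *: "A i k \<noteq> 0"
  \<comment> \<open>Chosen to make \<open>t * A i k\<close> equal to -(Re (A i i) + 1), so that the
    form takes the negative value -Re (A i i) - 2.\<close>
  define t where "t = - of_real ((Re (A i i) + 1) / (cmod (A i k))\<^sup>2) * cnj (A i k)"
  have "A k i = cnj (A i k)" using assms by (intro quad_form_nonneg_hermitian) auto
  then have "0 \<le> A i i + (t * A i k + cnj (t * A i k))"
    using assms(1)[of "\<lambda>j. (if j = i then 1 else 0) + (if j = k then t else 0)"]
    by (simp add: quad_form_pair[OF assms(2,3)] assms(4) add.assoc)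
  then have "0 \<le> Re (A i i) + 2 * Re (t * A i k)"
    by (simp add: less_eq_complex_def)
  moreover have "t * A i k = - of_real (Re (A i i) + 1)"
  proof -
    have "t * A i k = - of_real ((Re (A i i) + 1) / (cmod (A i k))\<^sup>2) * (A i k * cnj (A i k))"
      by (simp only: t_def mult_ac)
    also have "\<dots> = - of_real ((Re (A i i) + 1) / (cmod (A i k))\<^sup>2 * (cmod (A i k))\<^sup>2)"
      by (simp only: complex_norm_square[symmetric] of_real_mult mult_minus_left)
    finally show ?thesis using * by simp
  qed
  moreover have "0 \<le> Re (A i i)"
    using quad_form_nonneg_diag[OF assms(1,2)] by (simp add: less_eq_complex_def)
  ultimately show False by simp
qed

text \<open>Cholesky factorisation. Step m splits off one rank-one term and leaves a positive
  remainder whose rows and columns up to m are zero; after n steps nothing remains.\<close>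

lemma quad_form_nonneg_rank_one_sum:
  assumes "\<And>v. 0 \<le> quad_form n A v"
  shows "\<exists>u. \<forall>i<n. \<forall>j<n. A i j = (\<Sum>k<n. u k i * cnj (u k j))"
proof -
  have "\<exists>u C. (\<forall>v. 0 \<le> quad_form n C v) \<and>
      (\<forall>i<n. \<forall>j<n. A i j = (\<Sum>k<m. u k i * cnj (u k j)) + C i j) \<and>
      (\<forall>k<m. \<forall>i<n. C k i = 0 \<and> C i k = 0)" if "m \<le> n" for m
    using that
  proof (induction m)
    case 0
    show ?case using assms by (intro exI[of _ A]) auto
  next
    case (Suc m)
    then have "m \<le> n" by simp
    from Suc.IH[OF this] obtain u C where pos: "\<And>v. 0 \<le> quad_form n C v"
      and eq: "\<And>i j. i < n \<Longrightarrow> j < n \<Longrightarrow> A i j = (\<Sum>k<m. u k i * cnj (u k j)) + C i j"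
      and zero: "\<And>k i. k < m \<Longrightarrow> i < n \<Longrightarrow> C k i = 0 \<and> C i k = 0"
      by blast
    have m: "m < n" using Suc.prems by simp
    define r where "r = Re (C m m)"
    have r: "C m m = of_real r" "0 \<le> r"
      using quad_form_nonneg_diag[OF pos m] by (auto simp: r_def less_eq_complex_def complex_eq_iff)
    have herm: "C j i = cnj (C i j)" if "i < n" "j < n" for i j
      using quad_form_nonneg_hermitian[OF pos that] .
    have r0: "C i m = 0" if "i < n" "r = 0" for i
      using quad_form_nonneg_zero_diag[OF pos that(1) m] that r by simp
    \<comment> \<open>\<open>C'\<close> is the Schur complement of \<open>C\<close> at the pivot
      \<open>C m m\<close>. If the pivot is zero, division by zero gives \<open>C' = C\<close> and a
      zero vector \<open>u' m\<close>, and \<open>r0\<close> says that column m was zero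
      already.\<close>
    define C' where "C' i j = C i j - C i m * cnj (C j m) / of_real r" for i j
    define u' where "u' k i = (if k = m then C i m / of_real (sqrt r) else u k i)" for k i
    have "0 \<le> quad_form n C' v" for v
    proof (cases "r = 0")
      case True
      then show ?thesis using pos[of v] unfolding C'_def by simp
    next
      case False
      define z where "z = (\<Sum>j<n. C m j * v j)"
      have cm: "cnj (C j m) = C m j" if "j < n" for j
        using herm[OF that m] by simp
      have z': "(\<Sum>i<n. C i m * cnj (v i)) = cnj z"
        unfolding z_def using herm[OF m] by (simp add: cnj_sum)
      have "quad_form n C' v
        = quad_form n C v - (\<Sum>i<n. C i m * cnj (v i)) * (\<Sum>j<n. C m j * v j) / of_real r"
        unfolding quad_form_def C'_def sum_product sum_divide_distrib sum_subtractf[symmetric]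
        by (intro sum.cong refl) (simp add: cm algebra_simps)
      also have "\<dots> = quad_form n C v - cnj z * z / of_real r"
        unfolding z' by (simp add: z_def)
      \<comment> \<open>Completing the square: the correction is absorbed by moving the m-th
        coordinate of \<open>v\<close> to where the form of \<open>C\<close> is minimal.\<close>
      also have "\<dots> = quad_form n C (\<lambda>i. v i + (if i = m then - z / of_real r else 0))"
        unfolding quad_form_add_unit[OF m] z' z_def[symmetric] r(1)
        using False by (simp add: field_simps)
      finally show ?thesis using pos by simp
    qed
    moreover have "A i j = (\<Sum>k<Suc m. u' k i * cnj (u' k j)) + C' i j" if "i < n" "j < n" for i j
    proof -
      have "u' m i * cnj (u' m j) = C i m * cnj (C j m) / of_real r"
        using r(2) by (simp add: u'_def flip: of_real_mult)
      then show ?thesis using eq[OF that] by (simp add: u'_def C'_def)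
    qed
    moreover have "C' k i = 0 \<and> C' i k = 0" if "k < Suc m" "i < n" for k i
    proof (cases "k < m")
      case True
      then show ?thesis using zero m that by (simp add: C'_def)
    next
      case False
      then have k: "k = m" using that by simp
      have *: "C m i = cnj (C i m)" by (rule herm[OF that(2) m])
      show ?thesis
        using r0[OF that(2)] unfolding k C'_def r(1) * by (cases "r = 0") simp_all
    qed
    ultimately show ?case by (intro exI[of _ u'] exI[of _ C']) blast
  qed
  from this[OF order_refl] obtain u C
    where eq: "\<And>i j. i < n \<Longrightarrow> j < n \<Longrightarrow> A i j = (\<Sum>k<n. u k i * cnj (u k j)) + C i j"
      and zero: "\<And>k i. k < n \<Longrightarrow> i < n \<Longrightarrow> C k i = 0"
    by blast
  have "A i j = (\<Sum>k<n. u k i * cnj (u k j))" if "i < n" "j < n" for i j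
    using eq[OF that] zero[OF that] by simp
  then show ?thesis by blast
qed

lemma sum_swap_innermost:
  "(\<Sum>i\<in>A. \<Sum>j\<in>B. \<Sum>k\<in>C. f i j k) = (\<Sum>k\<in>C. \<Sum>i\<in>A. \<Sum>j\<in>B. f i j k)"
proof -
  have "(\<Sum>k\<in>C. \<Sum>i\<in>A. \<Sum>j\<in>B. f i j k) = (\<Sum>i\<in>A. \<Sum>k\<in>C. \<Sum>j\<in>B. f i j k)"
    by (rule sum.swap)
  also have "\<dots> = (\<Sum>i\<in>A. \<Sum>j\<in>B. \<Sum>k\<in>C. f i j k)"
    by (intro sum.cong refl sum.swap)
  finally show ?thesis ..
qed

text \<open>Each rank-one term contributes the squared modulus of one inner product. The index set
  \<open>K\<close> is an arbitrary finite set because tensor products need pairs as indices.\<close>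

lemma quad_form_rank_one_sum_nonneg:
  assumes "finite K" "\<And>i j. i < n \<Longrightarrow> j < n \<Longrightarrow> A i j = (\<Sum>k\<in>K. u k i * cnj (u k j))"
  shows "quad_form n A v = of_real (\<Sum>k\<in>K. (cmod (\<Sum>i<n. cnj (u k i) * v i))\<^sup>2)"
    and "0 \<le> quad_form n A v"
proof -
  have "quad_form n A v = (\<Sum>i<n. \<Sum>j<n. \<Sum>k\<in>K. (u k i * cnj (v i)) * (cnj (u k j) * v j))"
    unfolding quad_form_def using assms(2)
    by (intro sum.cong refl) (simp add: sum_distrib_right sum_distrib_left mult_ac)
  also have "\<dots> = (\<Sum>k\<in>K. (\<Sum>i<n. u k i * cnj (v i)) * (\<Sum>j<n. cnj (u k j) * v j))"
    unfolding sum_product by (rule sum_swap_innermost)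
  also have "\<dots> = of_real (\<Sum>k\<in>K. (cmod (\<Sum>i<n. cnj (u k i) * v i))\<^sup>2)"
    unfolding of_real_sum complex_norm_square by (simp add: mult.commute)
  finally show "quad_form n A v = of_real (\<Sum>k\<in>K. (cmod (\<Sum>i<n. cnj (u k i) * v i))\<^sup>2)" .
  then show "0 \<le> quad_form n A v"
    by (simp add: sum_nonneg less_eq_complex_def)
qed

section \<open>Positive matrices: traces, sums and tensor products\<close>

lemma pos_op_iff_quad_form:
  "pos_op n A \<longleftrightarrow> A \<in> carrier_mat n n \<and> (\<forall>v. 0 \<le> quad_form n (\<lambda>i j. A $$ (i, j)) v)"
proof (cases "A \<in> carrier_mat n n")
  case True
  have eq: "(A *\<^sub>v w) \<bullet>c w = quad_form n (\<lambda>i j. A $$ (i, j)) (\<lambda>i. w $ i)" if "w \<in> carrier_vec n" for w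
    using True that unfolding quad_form_def
    by (auto simp: scalar_prod_def sum_distrib_right atLeast0LessThan intro!: sum.cong)
  have "quad_form n (\<lambda>i j. A $$ (i, j)) v = (A *\<^sub>v vec n v) \<bullet>c vec n v" for v
    by (subst eq) (auto simp: quad_form_def)
  then show ?thesis using True eq unfolding pos_op_def by (metis vec_carrier)
qed (simp add: pos_op_def)

lemma pos_op_iff_rank_one_sum:
  "pos_op n A \<longleftrightarrow> A \<in> carrier_mat n n \<and>
    (\<exists>u. \<forall>i<n. \<forall>j<n. A $$ (i, j) = (\<Sum>k<n. u k i * cnj (u k j)))"
proof -
  have "0 \<le> quad_form n (\<lambda>i j. A $$ (i, j)) v"
    if "\<forall>i<n. \<forall>j<n. A $$ (i, j) = (\<Sum>k<n. u k i * cnj (u k j))" for u v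
    using that by (intro quad_form_rank_one_sum_nonneg(2)[of "{..<n}" _ _ u]) auto
  then show ?thesis
    using quad_form_nonneg_rank_one_sum[of n "\<lambda>i j. A $$ (i, j)"]
    unfolding pos_op_iff_quad_form by blast
qed

lemma pos_op_carrier: "pos_op n A \<Longrightarrow> A \<in> carrier_mat n n"
  by (simp add: pos_op_def)

lemma mat_trace_mult:
  assumes "A \<in> carrier_mat n n" "B \<in> carrier_mat n n"
  shows "mat_trace (A * B) = (\<Sum>i<n. \<Sum>j<n. A $$ (i, j) * B $$ (j, i))"
  using assms by (auto simp: mat_trace_def scalar_prod_def atLeast0LessThan intro!: sum.cong)

text \<open>Writing B as a sum of rank-one terms with vectors u_k turns the trace of AB into the sum
  of the values <A u_k, u_k>.\<close>

lemma mat_trace_mult_nonneg: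
  assumes "pos_op n A" "pos_op n B"
  shows "0 \<le> mat_trace (A * B)"
proof -
  from assms(2) obtain u where u: "\<And>i j. i < n \<Longrightarrow> j < n \<Longrightarrow> B $$ (i, j) = (\<Sum>k<n. u k i * cnj (u k j))"
    unfolding pos_op_iff_rank_one_sum by blast
  have "mat_trace (A * B) = (\<Sum>i<n. \<Sum>j<n. \<Sum>k<n. A $$ (i, j) * u k j * cnj (u k i))"
    unfolding mat_trace_mult[OF assms[THEN pos_op_carrier]]
    by (intro sum.cong refl) (simp add: u sum_distrib_left mult_ac)
  also have "\<dots> = (\<Sum>k<n. quad_form n (\<lambda>i j. A $$ (i, j)) (u k))"
    unfolding quad_form_def by (rule sum_swap_innermost)
  also have "0 \<le> \<dots>"
    using assms(1) by (intro sum_nonneg) (simp add: pos_op_iff_quad_form)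
  finally show ?thesis .
qed

lemma pos_op_add: "pos_op n A \<Longrightarrow> pos_op n B \<Longrightarrow> pos_op n (A + B)"
proof -
  assume A: "pos_op n A" and B: "pos_op n B"
  have "quad_form n (\<lambda>i j. (A + B) $$ (i, j)) v
    = quad_form n (\<lambda>i j. A $$ (i, j)) v + quad_form n (\<lambda>i j. B $$ (i, j)) v" for v
    using A B unfolding quad_form_def sum.distrib[symmetric]
    by (auto simp: algebra_simps dest!: pos_op_carrier intro!: sum.cong)
  then show ?thesis using A B by (simp add: pos_op_iff_quad_form)
qed

lemma pos_op_smult:
  assumes "pos_op n A" "0 \<le> c"
  shows "pos_op n (complex_of_real c \<cdot>\<^sub>m A)"
proof -
  have "quad_form n (\<lambda>i j. (complex_of_real c \<cdot>\<^sub>m A) $$ (i, j)) v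
    = of_real c * quad_form n (\<lambda>i j. A $$ (i, j)) v" for v
    using assms unfolding quad_form_def sum_distrib_left
    by (auto simp: mult.assoc dest!: pos_op_carrier intro!: sum.cong)
  moreover have "0 \<le> complex_of_real c" using assms by (simp add: less_eq_complex_def)
  ultimately show ?thesis using assms by (simp add: pos_op_iff_quad_form)
qed

text \<open>Rank-one decompositions of the factors with vectors u_k and w_l give one of the tensor
  product, with the product vectors of u_k and w_l.\<close>

lemma pos_op_tensor_mat:
  assumes "pos_op m A" "pos_op n B"
  shows "pos_op (m * n) (tensor_mat A B)"
proof -
  obtain u where u: "\<And>i j. i < m \<Longrightarrow> j < m \<Longrightarrow> A $$ (i, j) = (\<Sum>k<m. u k i * cnj (u k j))"
    using assms(1) unfolding pos_op_iff_rank_one_sum by blast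
  obtain w where w: "\<And>i j. i < n \<Longrightarrow> j < n \<Longrightarrow> B $$ (i, j) = (\<Sum>k<n. w k i * cnj (w k j))"
    using assms(2) unfolding pos_op_iff_rank_one_sum by blast
  have A: "A \<in> carrier_mat m m" and B: "B \<in> carrier_mat n n" using assms pos_op_carrier by auto
  have "tensor_mat A B $$ (i, j) = (\<Sum>(k, l)\<in>{..<m} \<times> {..<n}.
      u k (i div n) * w l (i mod n) * cnj (u k (j div n) * w l (j mod n)))"
    if "i < m * n" "j < m * n" for i j
  proof -
    have *: "i div n < m" "j div n < m" using that by (auto simp: less_mult_imp_div_less)
    have **: "i mod n < n" "j mod n < n" using that by (auto intro!: mod_less_divisor Nat.gr0I)
    show ?thesis
      using that A B unfolding tensor_mat_def sum.cartesian_product[symmetric]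
      by (simp add: u[OF *] w[OF **] sum_product mult_ac)
  qed
  then have "tensor_mat A B $$ (i, j) = (\<Sum>k\<in>{..<m} \<times> {..<n}.
      (\<lambda>(k, l) i. u k (i div n) * w l (i mod n)) k i *
      cnj ((\<lambda>(k, l) i. u k (i div n) * w l (i mod n)) k j))"
    if "i < m * n" "j < m * n" for i j
    using that by (simp add: case_prod_beta)
  then have "0 \<le> quad_form (m * n) (\<lambda>i j. tensor_mat A B $$ (i, j)) v" for v
    by (intro quad_form_rank_one_sum_nonneg(2)[of "{..<m} \<times> {..<n}"]) auto
  then show ?thesis
    using A B by (simp add: pos_op_iff_quad_form tensor_mat_def)
qed

lemma tensor_pow_carrier: "A \<in> carrier_mat d d \<Longrightarrow> tensor_pow A n \<in> carrier_mat (d ^ n) (d ^ n)"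
  by (induction n) (auto simp: tensor_mat_def)

lemma pos_op_one: "pos_op n (1\<^sub>m n)"
proof -
  have "quad_form n (\<lambda>i j. 1\<^sub>m n $$ (i, j)) v = (\<Sum>i<n. v i * cnj (v i))" for v
    unfolding quad_form_def
    by (intro sum.cong refl) (simp add: if_distrib[of "\<lambda>x. x * _"] cong: if_cong)
  also have "0 \<le> (\<Sum>i<n. v i * cnj (v i))" for v
    by (intro sum_nonneg) (simp add: less_eq_complex_def)
  finally show ?thesis by (simp add: pos_op_iff_quad_form)
qed

lemma pos_op_zero: "pos_op n (0\<^sub>m n n)"
  by (simp add: pos_op_iff_quad_form quad_form_def)

lemma pos_op_tensor_pow: "pos_op d A \<Longrightarrow> pos_op (d ^ n) (tensor_pow A n)"
  by (induction n) (auto simp: pos_op_one pos_op_tensor_mat)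

text \<open>Induction along a telescoping identity: the difference of the two products is (cB - A)
  tensored with \<open>c ^ n\<close> times the power of B, plus A tensored with the difference of
  the n-th powers. Both summands are tensor products of positive operators.\<close>

lemma op_le_tensor_pow:
  assumes "pos_op d A" "op_le d A (complex_of_real c \<cdot>\<^sub>m B)" "pos_op d B" "0 \<le> c"
  shows "op_le (d ^ n) (tensor_pow A n) (complex_of_real (c ^ n) \<cdot>\<^sub>m tensor_pow B n)"
proof (induction n)
  case 0
  have "complex_of_real 1 \<cdot>\<^sub>m 1\<^sub>m 1 - 1\<^sub>m 1 = 0\<^sub>m 1 1" by (intro eq_matI) auto
  then show ?case by (simp add: op_le_def pos_op_zero)
next
  case (Suc n)
  let ?A = "tensor_pow A n" and ?B = "tensor_pow B n"
  have A: "A \<in> carrier_mat d d" and B: "B \<in> carrier_mat d d" using assms pos_op_carrier by auto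
  note AB = tensor_pow_carrier[OF A, of n] tensor_pow_carrier[OF B, of n]
  have mod: "x mod d ^ n < d ^ n" if "x < d * d ^ n" for x
    using that by (intro mod_less_divisor Nat.gr0I) auto
  have "complex_of_real (c ^ Suc n) \<cdot>\<^sub>m tensor_pow B (Suc n) - tensor_pow A (Suc n)
    = tensor_mat (complex_of_real c \<cdot>\<^sub>m B - A) (complex_of_real (c ^ n) \<cdot>\<^sub>m ?B)
      + tensor_mat A (complex_of_real (c ^ n) \<cdot>\<^sub>m ?B - ?A)"
    using A B AB
    by (intro eq_matI) (auto simp: tensor_mat_def less_mult_imp_div_less mod algebra_simps)
  moreover have "pos_op (d * d ^ n) \<dots>"
    using assms Suc
    by (intro pos_op_add pos_op_tensor_mat pos_op_smult pos_op_tensor_pow) (auto simp: op_le_def)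
  ultimately show ?case
    using A B AB tensor_pow_carrier[OF A, of "Suc n"] tensor_pow_carrier[OF B, of "Suc n"]
    by (auto simp: op_le_def)
qed

subsection \<open>Support projections\<close>

text \<open>Gram-Schmidt, carried out on the projection instead of an orthonormal basis: each step
  adds the projection onto the part of the new vector orthogonal to the old span. The third conjunct
  puts the columns of \<open>p\<close> into the span, the fourth makes \<open>p\<close> fix the
  spanning vectors.\<close>

lemma projection_onto_span_exists:
  fixes a :: "nat \<Rightarrow> nat \<Rightarrow> complex"
  shows "\<exists>p x. (\<forall>i j. p j i = cnj (p i j)) \<and>
    (\<forall>i j. (\<Sum>k<n. p i k * p k j) = p i j) \<and>
    (\<forall>i j. p i j = (\<Sum>l<m. a l i * x l j)) \<and>
    (\<forall>l<m. \<forall>i<n. (\<Sum>k<n. p i k * a l k) = a l i)"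
proof (induction m)
  case 0
  show ?case by (rule exI[of _ "\<lambda>_ _. 0"]) auto
next
  case (Suc m)
  then obtain p x where herm: "\<And>i j. p j i = cnj (p i j)"
    and idem: "\<And>i j. (\<Sum>k<n. p i k * p k j) = p i j"
    and span: "\<And>i j. p i j = (\<Sum>l<m. a l i * x l j)"
    and fix_a: "\<And>l i. l < m \<Longrightarrow> i < n \<Longrightarrow> (\<Sum>k<n. p i k * a l k) = a l i"
    by blast
  define w where "w = a m"
  define u where "u i = w i - (\<Sum>k<n. p i k * w k)" for i
  define N where "N = (\<Sum>i<n. u i * cnj (u i))"
  have pu: "(\<Sum>k<n. p i k * u k) = 0" for i
  proof -
    have "(\<Sum>k<n. p i k * u k) = (\<Sum>k<n. p i k * w k) - (\<Sum>k<n. \<Sum>l<n. p i k * p k l * w l)"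
      by (simp add: u_def right_diff_distrib sum_subtractf sum_distrib_left mult.assoc)
    also have "(\<Sum>k<n. \<Sum>l<n. p i k * p k l * w l) = (\<Sum>l<n. (\<Sum>k<n. p i k * p k l) * w l)"
      by (subst sum.swap) (simp add: sum_distrib_right)
    finally show ?thesis by (simp add: idem)
  qed
  have up: "(\<Sum>k<n. cnj (u k) * p k i) = 0" for i
  proof -
    have "(\<Sum>k<n. cnj (u k) * p k i) = cnj (\<Sum>k<n. p i k * u k)"
      by (simp add: herm[of _ i] mult.commute)
    then show ?thesis by (simp add: pu)
  qed
  have up_fix: "(\<Sum>k<n. cnj (u k) * v k) = 0"
    if "\<And>i. i < n \<Longrightarrow> (\<Sum>k<n. p i k * v' k) = v i" for v v'
  proof -
    have "(\<Sum>k<n. cnj (u k) * v k) = (\<Sum>k<n. cnj (u k) * (\<Sum>l<n. p k l * v' l))"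
      using that by simp
    also have "\<dots> = (\<Sum>l<n. (\<Sum>k<n. cnj (u k) * p k l) * v' l)"
      by (simp add: sum_distrib_left sum_distrib_right mult.assoc) (rule sum.swap)
    finally show ?thesis by (simp add: up)
  qed
  have N_zero: "u i = 0" if "N = 0" "i < n" for i
  proof -
    have "N = of_real (\<Sum>i<n. (cmod (u i))\<^sup>2)"
      unfolding N_def of_real_sum by (intro sum.cong refl) (simp only: complex_norm_square)
    then have "(\<Sum>i<n. (cmod (u i))\<^sup>2) = 0" using that by (metis of_real_eq_0_iff)
    then show ?thesis using that by (subst (asm) sum_nonneg_eq_0_iff) auto
  qed
  \<comment> \<open>If \<open>N = 0\<close>, the new vector already lies in the span,
    \<open>u\<close> vanishes below \<open>n\<close>, and division by zero removes the added term.
    Factors \<open>N / N\<close> cover this case together with the regular one.\<close>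
  have uN: "u i * (N / N) = u i" if "i < n" for i
    using N_zero[OF _ that] by (cases "N = 0") auto
  have NN: "z * (N / N) / N = z / N" for z by (cases "N = 0") auto
  define p' where "p' i j = p i j + u i * cnj (u j) / N" for i j
  have cN: "cnj N = N" unfolding N_def by (simp add: mult.commute)
  have herm': "p' j i = cnj (p' i j)" for i j
    unfolding p'_def by (simp add: cN herm[of j i] mult.commute)
  have idem': "(\<Sum>k<n. p' i k * p' k j) = p' i j" for i j
  proof -
    have "(\<Sum>k<n. p' i k * p' k j) = (\<Sum>k<n. p i k * p k j) + (\<Sum>k<n. p i k * u k) * (cnj (u j) / N)
       + (u i / N) * (\<Sum>k<n. cnj (u k) * p k j) + u i * cnj (u j) * ((\<Sum>k<n. u k * cnj (u k)) / N) / N"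
      unfolding p'_def
      by (simp add: algebra_simps sum.distrib sum_distrib_left sum_distrib_right sum_divide_distrib)
    then show ?thesis
      unfolding N_def[symmetric] by (simp only: pu up idem NN) (simp add: p'_def)
  qed
  \<comment> \<open>\<open>y\<close> holds the coefficients of \<open>p\<close> applied to
    \<open>w\<close>. The new coefficients \<open>x'\<close> come from substituting \<open>w\<close>
    minus that combination for \<open>u\<close> in the added term.\<close>
  define y where "y l = (\<Sum>j<n. x l j * w j)" for l
  define x' where "x' l j = (if l < m then x l j - y l * cnj (u j) / N else cnj (u j) / N)" for l j
  have u_span: "u i = w i - (\<Sum>l<m. a l i * y l)" for i
  proof -
    have "(\<Sum>k<n. p i k * w k) = (\<Sum>k<n. \<Sum>l<m. a l i * x l k * w k)"
      by (simp add: span[of i] sum_distrib_right)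
    also have "\<dots> = (\<Sum>l<m. a l i * y l)"
      by (subst sum.swap) (simp add: y_def sum_distrib_left mult.assoc)
    finally show ?thesis by (simp add: u_def)
  qed
  have span': "p' i j = (\<Sum>l<Suc m. a l i * x' l j)" for i j
  proof -
    have "(\<Sum>l<Suc m. a l i * x' l j)
      = (\<Sum>l<m. a l i * x l j) - (\<Sum>l<m. a l i * y l) * (cnj (u j) / N) + w i * (cnj (u j) / N)"
      by (simp add: x'_def w_def right_diff_distrib sum_subtractf sum_distrib_right sum_divide_distrib mult.assoc)
    also have "\<dots> = (\<Sum>l<m. a l i * x l j) + u i * (cnj (u j) / N)"
      unfolding u_span[of i] by (simp add: algebra_simps)
    finally show ?thesis by (simp add: p'_def span[of i j])
  qed
  have p'_app: "(\<Sum>k<n. p' i k * v k) = (\<Sum>k<n. p i k * v k) + u i * ((\<Sum>k<n. cnj (u k) * v k) / N)" for i v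
    unfolding p'_def
    by (simp add: algebra_simps sum.distrib sum_distrib_left sum_divide_distrib)
  have "(\<Sum>k<n. p' i k * a l k) = a l i" if "l < Suc m" "i < n" for l i
  proof (cases "l < m")
    case True
    then have "(\<Sum>k<n. cnj (u k) * a l k) = 0"
      using fix_a by (intro up_fix[of "a l"]) auto
    then show ?thesis unfolding p'_app using fix_a[OF True that(2)] by simp
  next
    case False
    then have l: "a l = w" using that by (simp add: w_def less_Suc_eq)
    \<comment> \<open>The difference \<open>w - u\<close> is the image of \<open>w\<close> under
      \<open>p\<close>, hence orthogonal to \<open>u\<close>. So the inner product of
      \<open>w\<close> with \<open>u\<close> is \<open>N\<close>, and \<open>p'\<close> adds exactly
      \<open>u\<close> to that image.\<close>
    have "(\<Sum>k<n. cnj (u k) * w k) - N = (\<Sum>k<n. cnj (u k) * (\<Sum>l<n. p k l * w l))"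
      unfolding N_def sum_subtractf[symmetric] by (intro sum.cong refl) (simp add: u_def algebra_simps)
    also have "\<dots> = 0" by (rule up_fix[of w]) simp
    finally have "(\<Sum>k<n. cnj (u k) * w k) = N" by simp
    then have "(\<Sum>k<n. p' i k * a l k) = (\<Sum>k<n. p i k * w k) + u i"
      unfolding p'_app l using uN[OF that(2)] by simp
    then show ?thesis by (simp add: u_def l)
  qed
  then show ?case using herm' idem' span' by (intro exI[of _ p'] exI[of _ x']) blast
qed

section \<open>Range projections of matrices and their uniqueness\<close>

lemma projection_op_iff:
  "projection_op n P \<longleftrightarrow> P \<in> carrier_mat n n \<and>
    (\<forall>i<n. \<forall>j<n. cnj (P $$ (i, j)) = P $$ (j, i)) \<and> P * P = P"
proof (cases "P \<in> carrier_mat n n")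
  case True
  then have adj: "mat_adjoint P \<in> carrier_mat n n"
    "\<And>i j. i < n \<Longrightarrow> j < n \<Longrightarrow> mat_adjoint P $$ (j, i) = cnj (P $$ (i, j))"
    by (auto simp: mat_adjoint_def mat_of_rows_def)
  have "mat_adjoint P = P \<longleftrightarrow> (\<forall>i<n. \<forall>j<n. mat_adjoint P $$ (j, i) = P $$ (j, i))"
    using True adj(1) by (auto intro!: eq_matI)
  then show ?thesis using True adj(2) by (simp add: projection_op_def)
qed (simp add: projection_op_def)

lemma projection_opD:
  assumes "projection_op n P"
  shows "P \<in> carrier_mat n n" "P * P = P"
    "i < n \<Longrightarrow> j < n \<Longrightarrow> P $$ (j, i) = cnj (P $$ (i, j))"
  using assms by (auto simp: projection_op_iff)

lemma mat_mult_index: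
  assumes "A \<in> carrier_mat n n" "B \<in> carrier_mat n n" "i < n" "j < n"
  shows "(A * B) $$ (i, j) = (\<Sum>k<n. A $$ (i, k) * B $$ (k, j))"
  using assms by (simp add: scalar_prod_def atLeast0LessThan)

text \<open>The span in question is that of the columns of \<open>A\<close>. The two equations
  between \<open>P\<close> and \<open>A\<close> express equality of their ranges without mentioning
  vectors.\<close>

lemma range_projection_exists:
  assumes "A \<in> carrier_mat n n"
  obtains P X where "projection_op n P" "X \<in> carrier_mat n n" "P = A * X" "P * A = A"
proof -
  obtain p x where *: "\<And>i j. p j i = cnj (p i j)" "\<And>i j. (\<Sum>k<n. p i k * p k j) = p i j"
    "\<And>i j. p i j = (\<Sum>l<n. A $$ (i, l) * x l j)"
    "\<And>l i. l < n \<Longrightarrow> i < n \<Longrightarrow> (\<Sum>k<n. p i k * A $$ (k, l)) = A $$ (i, l)"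
    using projection_onto_span_exists[where n = n and m = n and a = "\<lambda>l i. A $$ (i, l)"] by blast
  define P X where "P = mat n n (\<lambda>(i, j). p i j)" and "X = mat n n (\<lambda>(i, j). x i j)"
  have carrier: "P \<in> carrier_mat n n" "X \<in> carrier_mat n n" by (auto simp: P_def X_def)
  have entries: "P $$ (i, j) = p i j" "X $$ (i, j) = x i j" if "i < n" "j < n" for i j
    using that by (auto simp: P_def X_def)
  have "P * P = P"
  proof (rule eq_matI)
    fix i j assume "i < dim_row P" "j < dim_col P"
    then show "(P * P) $$ (i, j) = P $$ (i, j)"
      using carrier by (simp add: mat_mult_index[OF carrier(1) carrier(1)] entries *(2) del: index_mult_mat)
  qed (use carrier in auto)
  moreover have "P = A * X"
  proof (rule eq_matI)
    fix i j assume "i < dim_row (A * X)" "j < dim_col (A * X)"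
    then show "P $$ (i, j) = (A * X) $$ (i, j)"
      using carrier assms by (simp add: mat_mult_index[OF assms carrier(2)] entries *(3)[of i j] del: index_mult_mat(1))
  qed (use carrier assms in auto)
  moreover have "P * A = A"
  proof (rule eq_matI)
    fix i j assume "i < dim_row A" "j < dim_col A"
    then show "(P * A) $$ (i, j) = A $$ (i, j)"
      using carrier assms by (simp add: mat_mult_index[OF carrier(1) assms] entries *(4) del: index_mult_mat(1))
  qed (use carrier assms in auto)
  moreover have "\<forall>i<n. \<forall>j<n. cnj (P $$ (i, j)) = P $$ (j, i)"
    by (simp add: entries *(1)[symmetric])
  ultimately show ?thesis
    using that carrier by (simp add: projection_op_iff)
qed

lemma eq_mat_mult_vecI:
  fixes A B :: "'a :: comm_semiring_1 mat"
  assumes "A \<in> carrier_mat m n" "B \<in> carrier_mat m n"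
    and "\<And>v. v \<in> carrier_vec n \<Longrightarrow> A *\<^sub>v v = B *\<^sub>v v"
  shows "A = B"
proof (rule eq_matI)
  fix i j assume ij: "i < dim_row B" "j < dim_col B"
  have "(A *\<^sub>v unit_vec n j) $ i = (B *\<^sub>v unit_vec n j) $ i" by (simp add: assms(3))
  then show "A $$ (i, j) = B $$ (i, j)"
    using ij assms(1,2) by (auto simp: scalar_prod_right_unit)
qed (use assms in auto)

lemma projection_op_mult_left:
  assumes P: "projection_op n P" and B: "B \<in> carrier_mat n n"
    and range: "(\<lambda>v. B *\<^sub>v v) ` carrier_vec n \<subseteq> (\<lambda>v. P *\<^sub>v v) ` carrier_vec n"
  shows "P * B = B"
proof (rule eq_mat_mult_vecI[of _ n n])
  note carrier = P[unfolded projection_op_def, THEN conjunct1]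
  show "P * B \<in> carrier_mat n n" using carrier B by simp
  fix v :: "complex vec" assume v: "v \<in> carrier_vec n"
  obtain w where w: "w \<in> carrier_vec n" "B *\<^sub>v v = P *\<^sub>v w" using range v by blast
  have "(P * B) *\<^sub>v v = P *\<^sub>v (P *\<^sub>v w)"
    using v w carrier B by (metis assoc_mult_mat_vec)
  also have "\<dots> = B *\<^sub>v v"
    using P w carrier by (metis assoc_mult_mat_vec projection_op_def)
  finally show "(P * B) *\<^sub>v v = B *\<^sub>v v" .
qed (use B in simp)

text \<open>Each projection fixes the range of the other, so PQ = Q and QP = P. Taking adjoints in
  the second equation gives P = PQ, hence P = Q.\<close>

lemma projection_op_eq_of_range_eq:
  assumes P: "projection_op n P" and Q: "projection_op n Q"
    and range: "(\<lambda>v. P *\<^sub>v v) ` carrier_vec n = (\<lambda>v. Q *\<^sub>v v) ` carrier_vec n"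
  shows "P = Q"
proof -
  have carrier: "P \<in> carrier_mat n n" "Q \<in> carrier_mat n n"
    and herm: "\<And>i j. i < n \<Longrightarrow> j < n \<Longrightarrow> P $$ (j, i) = cnj (P $$ (i, j))"
      "\<And>i j. i < n \<Longrightarrow> j < n \<Longrightarrow> Q $$ (j, i) = cnj (Q $$ (i, j))"
    using projection_opD[OF P] projection_opD[OF Q] by blast+
  have PQ: "P * Q = Q" and QP: "Q * P = P"
    using projection_op_mult_left[OF P carrier(2)] projection_op_mult_left[OF Q carrier(1)] range by auto
  show ?thesis
  proof (rule eq_matI)
    fix i j assume "i < dim_row Q" "j < dim_col Q"
    then have ij: "i < n" "j < n" using carrier by auto
    have "P $$ (i, j) = cnj ((Q * P) $$ (j, i))" using herm(1) ij QP by metis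
    also have "\<dots> = (\<Sum>k<n. cnj (Q $$ (j, k)) * cnj (P $$ (k, i)))"
      using mat_mult_index[OF carrier(2,1) ij(2,1)] by (simp add: cnj_sum)
    also have "\<dots> = (\<Sum>k<n. P $$ (i, k) * Q $$ (k, j))"
      using ij by (intro sum.cong refl) (simp add: herm(1)[of _ i] herm(2)[of j] mult.commute)
    also have "\<dots> = (P * Q) $$ (i, j)"
      using mat_mult_index[OF carrier ij] by simp
    finally show "P $$ (i, j) = Q $$ (i, j)" by (simp only: PQ)
  qed (use carrier in auto)
qed

text \<open>Existence and uniqueness of the range projection resolve the definite description; later
  arguments about supports rest on these three facts only.\<close>

lemma support_proj_props:
  assumes A: "A \<in> carrier_mat n n"
  shows "projection_op n (support_proj n A)" "support_proj n A * A = A"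
    "\<exists>X \<in> carrier_mat n n. support_proj n A = A * X"
proof -
  obtain P X where P: "projection_op n P" "X \<in> carrier_mat n n" "P = A * X" "P * A = A"
    using range_projection_exists[OF A] .
  have carrier: "P \<in> carrier_mat n n" using P by (simp add: projection_op_def)
  have range: "(\<lambda>v. P *\<^sub>v v) ` carrier_vec n = (\<lambda>v. A *\<^sub>v v) ` carrier_vec n"
  proof (intro equalityI image_subsetI)
    fix v :: "complex vec" assume v: "v \<in> carrier_vec n"
    have "P *\<^sub>v v = A *\<^sub>v (X *\<^sub>v v)" unfolding P(3) using A P(2) v by (rule assoc_mult_mat_vec)
    then show "P *\<^sub>v v \<in> (\<lambda>v. A *\<^sub>v v) ` carrier_vec n"
      using P(2) v by (metis image_eqI mult_mat_vec_carrier)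
  next
    fix v :: "complex vec" assume v: "v \<in> carrier_vec n"
    have "A *\<^sub>v v = P *\<^sub>v (A *\<^sub>v v)" using assoc_mult_mat_vec[OF carrier A v] P(4) by simp
    then show "A *\<^sub>v v \<in> (\<lambda>v. P *\<^sub>v v) ` carrier_vec n"
      using A v by (metis image_eqI mult_mat_vec_carrier)
  qed
  have "support_proj n A = P"
    unfolding support_proj_def
  proof (rule the_equality)
    show "projection_op n P \<and> (\<lambda>v. P *\<^sub>v v) ` carrier_vec n = (\<lambda>v. A *\<^sub>v v) ` carrier_vec n"
      using P(1) range by blast
    fix Q assume "projection_op n Q \<and> (\<lambda>v. Q *\<^sub>v v) ` carrier_vec n = (\<lambda>v. A *\<^sub>v v) ` carrier_vec n"
    then show "Q = P" using projection_op_eq_of_range_eq[of n Q P] P(1) range by simp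
  qed
  then show "projection_op n (support_proj n A)" "support_proj n A * A = A"
    "\<exists>X \<in> carrier_mat n n. support_proj n A = A * X"
    using P by auto
qed

section \<open>Operator inequalities between states of equal support\<close>

text \<open>A coordinate form of P \<le> C A. As P is self-adjoint and equal to AX, it is also the
  adjoint of X times A; so the entries of Pv are combinations of the inner products of v with the
  vectors u_l of a decomposition of A, and their squared moduli sum to <Av, v>.\<close>

lemma support_proj_le_quad_form:
  assumes "pos_op n A"
  defines "P \<equiv> support_proj n A"
  obtains K where "0 \<le> K"
    "\<And>v i. i < n \<Longrightarrow>
      cmod (\<Sum>j<n. P $$ (i, j) * v j) \<le> K * sqrt (Re (quad_form n (\<lambda>i j. A $$ (i, j)) v))"
proof -
  have A: "A \<in> carrier_mat n n" using assms pos_op_carrier by blast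
  obtain u where u: "\<And>i j. i < n \<Longrightarrow> j < n \<Longrightarrow> A $$ (i, j) = (\<Sum>k<n. u k i * cnj (u k j))"
    using assms(1) unfolding pos_op_iff_rank_one_sum by blast
  obtain X where X: "X \<in> carrier_mat n n" "P = A * X"
    using support_proj_props(3)[OF A] P_def by blast
  have hermP: "P $$ (j, i) = cnj (P $$ (i, j))" if "i < n" "j < n" for i j
    unfolding P_def using support_proj_props(1)[OF A] that by (rule projection_opD(3))
  \<comment> \<open>\<open>a i l\<close> is the i-th entry of the adjoint of X applied to u_l.
    Summing over \<open>i\<close> as well makes \<open>K\<close> a bound uniform in
    \<open>i\<close>.\<close>
  define a where "a i l = (\<Sum>k<n. cnj (X $$ (k, i)) * u l k)" for i l
  define K where "K = (\<Sum>i<n. \<Sum>l<n. cmod (a i l))"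
  have P_entry: "P $$ (i, j) = (\<Sum>l<n. a i l * cnj (u l j))" if "i < n" "j < n" for i j
  proof -
    have "P $$ (i, j) = cnj (\<Sum>k<n. A $$ (j, k) * X $$ (k, i))"
      using hermP[OF that(2,1)] mat_mult_index[OF A X(1) that(2,1)] X(2) by simp
    also have "\<dots> = (\<Sum>k<n. \<Sum>l<n. cnj (X $$ (k, i)) * u l k * cnj (u l j))"
      using that by (simp add: cnj_sum u sum_distrib_left sum_distrib_right mult_ac)
    also have "\<dots> = (\<Sum>l<n. a i l * cnj (u l j))"
      by (subst sum.swap) (simp add: a_def sum_distrib_right)
    finally show ?thesis .
  qed
  have "cmod (\<Sum>j<n. P $$ (i, j) * v j) \<le> K * sqrt (Re (quad_form n (\<lambda>i j. A $$ (i, j)) v))"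
    if "i < n" for v i
  proof -
    define s where "s l = (\<Sum>j<n. cnj (u l j) * v j)" for l
    define Q where "Q = Re (quad_form n (\<lambda>i j. A $$ (i, j)) v)"
    have Q: "Q = (\<Sum>l<n. (cmod (s l))\<^sup>2)"
      unfolding Q_def s_def using u by (subst quad_form_rank_one_sum_nonneg(1)[of "{..<n}" _ _ u]) auto
    have s: "cmod (s l) \<le> sqrt Q" if "l < n" for l
      unfolding Q using that by (intro real_le_rsqrt member_le_sum) auto
    have "(\<Sum>j<n. P $$ (i, j) * v j) = (\<Sum>j<n. \<Sum>l<n. a i l * (cnj (u l j) * v j))"
      using that by (simp add: P_entry sum_distrib_right mult.assoc)
    also have "\<dots> = (\<Sum>l<n. a i l * s l)"
      by (subst sum.swap) (simp add: s_def sum_distrib_left)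
    also have "cmod \<dots> \<le> (\<Sum>l<n. cmod (a i l) * sqrt Q)"
      by (intro sum_norm_le) (auto simp: norm_mult intro!: mult_left_mono s)
    also have "\<dots> = (\<Sum>l<n. cmod (a i l)) * sqrt Q" by (simp add: sum_distrib_right)
    also have "\<dots> \<le> K * sqrt Q"
    proof (rule mult_right_mono)
      show "(\<Sum>l<n. cmod (a i l)) \<le> K"
        unfolding K_def using that
        by (intro member_le_sum[of i _ "\<lambda>i. \<Sum>l<n. cmod (a i l)"]) (auto intro: sum_nonneg)
      show "0 \<le> sqrt Q" unfolding Q by (simp add: sum_nonneg)
    qed
    finally show ?thesis unfolding Q_def .
  qed
  moreover have "0 \<le> K" unfolding K_def by (simp add: sum_nonneg)
  ultimately show ?thesis using that by blast
qed

text \<open>Equality of supports gives PDP = D for the difference D = B - A. Hence <Dv, v> = <D Pv,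
  Pv>, which is at most \<delta> times n^2 K^2 <Av, v>: entrywise closeness becomes a bound relative
  to A.\<close>

lemma op_le_of_entries_close:
  assumes A: "pos_op n A" and "0 < e"
  obtains \<delta> where "0 < \<delta>"
    "\<And>B. pos_op n B \<Longrightarrow> support_proj n B = support_proj n A \<Longrightarrow>
      (\<And>i j. i < n \<Longrightarrow> j < n \<Longrightarrow> cmod (B $$ (i, j) - A $$ (i, j)) \<le> \<delta>) \<Longrightarrow>
      op_le n B (complex_of_real (1 + e) \<cdot>\<^sub>m A)"
proof -
  define P where "P = support_proj n A"
  obtain K where K: "0 \<le> K" "\<And>v i. i < n \<Longrightarrow>
      cmod (\<Sum>j<n. P $$ (i, j) * v j) \<le> K * sqrt (Re (quad_form n (\<lambda>i j. A $$ (i, j)) v))"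
    using support_proj_le_quad_form[OF A] unfolding P_def by blast
  \<comment> \<open>The n^2 terms of the form, each with two factors \<open>K\<close>, must sum to
    at most \<open>e\<close>; the added 1 keeps the denominator positive when \<open>K\<close> or
    \<open>n\<close> is zero.\<close>
  define \<delta> where "\<delta> = e / ((real n)\<^sup>2 * K\<^sup>2 + 1)"
  have pos: "0 < (real n)\<^sup>2 * K\<^sup>2 + 1" by (simp add: add_nonneg_pos)
  then have "0 < \<delta>" using assms(2) by (simp add: \<delta>_def)
  have \<delta>_le: "\<delta> * ((real n)\<^sup>2 * K\<^sup>2) \<le> e"
  proof -
    have "\<delta> * ((real n)\<^sup>2 * K\<^sup>2) \<le> \<delta> * ((real n)\<^sup>2 * K\<^sup>2 + 1)"
      using \<open>0 < \<delta>\<close> by (intro mult_left_mono) auto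
    also have "\<dots> = e" using pos by (simp add: \<delta>_def)
    finally show ?thesis .
  qed
  have carA: "A \<in> carrier_mat n n" using A pos_op_carrier by blast
  have proj: "projection_op n P" and PA: "P * A = A"
    using support_proj_props[OF carA] by (auto simp: P_def)
  then have carP: "P \<in> carrier_mat n n" by (simp add: projection_op_def)
  have hermP: "P $$ (j, i) = cnj (P $$ (i, j))" if "i < n" "j < n" for i j
    using proj that by (rule projection_opD(3))
  have "op_le n B (complex_of_real (1 + e) \<cdot>\<^sub>m A)"
    if B: "pos_op n B" "support_proj n B = support_proj n A"
      and close: "\<And>i j. i < n \<Longrightarrow> j < n \<Longrightarrow> cmod (B $$ (i, j) - A $$ (i, j)) \<le> \<delta>" for B
  proof -
    have carB: "B \<in> carrier_mat n n" using B pos_op_carrier by blast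
    have PB: "P * B = B" using support_proj_props(2)[OF carB] B(2) by (simp add: P_def)
    define D where "D i j = B $$ (i, j) - A $$ (i, j)" for i j
    have hermD: "D j i = cnj (D i j)" if "i < n" "j < n" for i j
      using A B(1) that quad_form_nonneg_hermitian[of n "\<lambda>i j. A $$ (i, j)" i j]
        quad_form_nonneg_hermitian[of n "\<lambda>i j. B $$ (i, j)" i j]
      unfolding pos_op_iff_quad_form D_def by simp
    have PD: "(\<Sum>k<n. P $$ (i, k) * D k j) = D i j" if "i < n" "j < n" for i j
      using mat_mult_index[OF carP carA that] mat_mult_index[OF carP carB that] PA PB
      by (simp add: D_def right_diff_distrib sum_subtractf)
    have DP: "(\<Sum>k<n. D i k * P $$ (k, j)) = D i j" if "i < n" "j < n" for i j
    proof -
      have "(\<Sum>k<n. D i k * P $$ (k, j)) = cnj (\<Sum>k<n. P $$ (j, k) * D k i)"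
        unfolding cnj_sum using that
        by (intro sum.cong refl) (simp add: hermP[of j] hermD[of _ i] mult.commute)
      then show ?thesis using PD[OF that(2,1)] hermD[OF that(2,1)] by simp
    qed
    have "0 \<le> quad_form n (\<lambda>i j. (complex_of_real (1 + e) \<cdot>\<^sub>m A - B) $$ (i, j)) v" for v
    proof -
      define Q where "Q = Re (quad_form n (\<lambda>i j. A $$ (i, j)) v)"
      have qA: "quad_form n (\<lambda>i j. A $$ (i, j)) v = of_real Q" "0 \<le> Q"
        using A by (auto simp: pos_op_iff_quad_form Q_def less_eq_complex_def complex_eq_iff)
      have qB: "Im (quad_form n (\<lambda>i j. B $$ (i, j)) v) = 0"
        using B(1) by (simp add: pos_op_iff_quad_form less_eq_complex_def)
      have qD: "quad_form n D v = quad_form n (\<lambda>i j. B $$ (i, j)) v - of_real Q"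
        unfolding qA(1)[symmetric] quad_form_def D_def sum_subtractf[symmetric]
        by (simp add: left_diff_distrib)
      define x y where "x i = (\<Sum>j<n. P $$ (i, j) * v j)" and "y i = (\<Sum>j<n. D i j * v j)" for i
      have y: "(\<Sum>j<n. D i j * x j) = y i" if "i < n" for i
      proof -
        have "(\<Sum>j<n. D i j * x j) = (\<Sum>k<n. (\<Sum>j<n. D i j * P $$ (j, k)) * v k)"
          unfolding x_def sum_distrib_left sum_distrib_right by (subst sum.swap) (simp add: mult.assoc)
        then show ?thesis using that by (simp add: DP y_def)
      qed
      have Py: "(\<Sum>i<n. P $$ (k, i) * y i) = y k" if "k < n" for k
      proof -
        have "(\<Sum>i<n. P $$ (k, i) * y i) = (\<Sum>j<n. (\<Sum>i<n. P $$ (k, i) * D i j) * v j)"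
          unfolding y_def sum_distrib_left sum_distrib_right by (subst sum.swap) (simp add: mult.assoc)
        then show ?thesis using that by (simp add: PD y_def)
      qed
      \<comment> \<open>With x = Pv and y = Dv, the relation DP = D replaces Dx by y; moving P to
        the other side then meets Py = y.\<close>
      have "quad_form n D x = (\<Sum>i<n. (\<Sum>j<n. D i j * x j) * cnj (x i))"
        unfolding quad_form_def by (simp add: sum_distrib_right)
      also have "\<dots> = (\<Sum>i<n. \<Sum>k<n. y i * cnj (P $$ (i, k)) * cnj (v k))"
        by (simp add: y) (simp add: x_def sum_distrib_left mult.assoc)
      also have "\<dots> = (\<Sum>k<n. (\<Sum>i<n. P $$ (k, i) * y i) * cnj (v k))"
        unfolding sum_distrib_right by (subst sum.swap) (simp add: hermP[symmetric] mult_ac)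
      also have "\<dots> = quad_form n D v"
        by (simp add: Py) (simp add: quad_form_def y_def sum_distrib_right)
      finally have "quad_form n D v = quad_form n D x" ..
      also have "cmod \<dots> \<le> (\<Sum>i<n. \<Sum>j<n. \<delta> * (K * sqrt Q) * (K * sqrt Q))"
      proof -
        have x: "cmod (x i) \<le> K * sqrt Q" if "i < n" for i
          unfolding x_def Q_def using that by (rule K(2))
        show ?thesis
          unfolding quad_form_def using close K(1) \<open>0 < \<delta>\<close> qA(2)
          by (intro sum_norm_le) (auto simp: norm_mult D_def intro!: mult_mono x)
      qed
      also have "\<dots> = \<delta> * ((real n)\<^sup>2 * K\<^sup>2) * Q"
        using qA(2) by (simp add: power2_eq_square)
      also have "\<dots> \<le> e * Q" using \<delta>_le qA(2) by (rule mult_right_mono)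
      finally have "Re (quad_form n D v) \<le> e * Q" using complex_Re_le_cmod order_trans by blast
      then have le: "Re (quad_form n (\<lambda>i j. B $$ (i, j)) v) - Q \<le> e * Q" by (simp add: qD)
      have eq: "quad_form n (\<lambda>i j. (complex_of_real (1 + e) \<cdot>\<^sub>m A - B) $$ (i, j)) v
        = of_real (1 + e) * quad_form n (\<lambda>i j. A $$ (i, j)) v - quad_form n (\<lambda>i j. B $$ (i, j)) v"
        unfolding quad_form_def sum_distrib_left sum_subtractf[symmetric]
        using carA carB by (intro sum.cong refl) (simp add: algebra_simps)
      show ?thesis
        unfolding eq qA(1) less_eq_complex_def using le qB by (simp add: distrib_right)
    qed
    then show ?thesis using carA carB by (simp add: op_le_def pos_op_iff_quad_form minus_carrier_mat)
  qed
  then show ?thesis using that[OF \<open>0 < \<delta>\<close>] by blast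
qed

subsection \<open>Countable dense subsets\<close>

text \<open>Read as functions on index pairs, matrices lie in a second countable metric space, so
  every set of them has a countable dense subset. Closeness at finitely many entries is an open
  condition there.\<close>

lemma countable_entrywise_dense_subset:
  fixes R :: "complex mat set" and n :: nat
  shows "\<exists>R'. countable R' \<and> R' \<subseteq> R \<and>
    (\<forall>A\<in>R. \<forall>e>0. \<exists>B\<in>R'. \<forall>i<n. \<forall>j<n. cmod (B $$ (i, j) - A $$ (i, j)) < e)"
proof -
  define F :: "complex mat \<Rightarrow> nat \<times> nat \<Rightarrow> complex" where "F A x = A $$ x" for A x
  obtain T where T: "countable T" "T \<subseteq> F ` R" "F ` R \<subseteq> closure T"
    using separable[of "F ` R"] .
  have "\<exists>B\<in>inv_into R F ` T. \<forall>i<n. \<forall>j<n. cmod (B $$ (i, j) - A $$ (i, j)) < e"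
    if "A \<in> R" "0 < e" for A e
  proof -
    define U where "U = (\<Inter>x\<in>{..<n} \<times> {..<n}. {f. cmod (f x - F A x) < e})"
    have "open U"
      unfolding U_def
      by (intro open_INT ballI open_Collect_less continuous_intros continuous_on_product_coordinates) auto
    moreover have "F A \<in> U" using that by (simp add: U_def)
    then have "U \<inter> closure T \<noteq> {}" using T(3) that(1) by auto
    ultimately have "U \<inter> T \<noteq> {}" by (simp add: open_Int_closure_eq_empty)
    then obtain f where f: "f \<in> U" "f \<in> T" by auto
    have "F (inv_into R F f) = f" using f(2) T(2) by (intro f_inv_into_f) auto
    moreover have "cmod (f (i, j) - F A (i, j)) < e" if "i < n" "j < n" for i j
      using f(1) that by (simp add: U_def)
    ultimately have "cmod (inv_into R F f $$ (i, j) - A $$ (i, j)) < e" if "i < n" "j < n" for i j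
      using that by (metis F_def)
    then show ?thesis using f(2) by auto
  qed
  moreover have "countable (inv_into R F ` T)" "inv_into R F ` T \<subseteq> R"
    using T by (auto intro: inv_into_into)
  ultimately show ?thesis by (intro exI[of _ "inv_into R F ` T"]) simp
qed

text \<open>The approximating states must share the support of the given one, so a dense subset is
  chosen inside each non-empty R_P separately; a countable union of these is still
  countable.\<close>

lemma countable_max_rel_entropy_dense_subset:
  assumes dens: "\<And>\<rho>. \<rho> \<in> R \<Longrightarrow> density_op d \<rho>"
    and cnt: "countable {P. projection_op d P \<and> {\<rho> \<in> R. support_proj d \<rho> = P} \<noteq> {}}"
  obtains R' where "countable R'" "max_rel_entropy_dense d R' R"
proof -
  define \<P> where "\<P> = {P. projection_op d P \<and> {\<rho> \<in> R. support_proj d \<rho> = P} \<noteq> {}}"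
  have "\<forall>P. \<exists>D. countable D \<and> D \<subseteq> {\<rho> \<in> R. support_proj d \<rho> = P} \<and>
      (\<forall>A\<in>{\<rho> \<in> R. support_proj d \<rho> = P}. \<forall>e>0.
        \<exists>B\<in>D. \<forall>i<d. \<forall>j<d. cmod (B $$ (i, j) - A $$ (i, j)) < e)"
    by (intro allI countable_entrywise_dense_subset)
  from choice[OF this] obtain D where D': "\<And>P. countable (D P) \<and>
      D P \<subseteq> {\<rho> \<in> R. support_proj d \<rho> = P} \<and>
      (\<forall>A\<in>{\<rho> \<in> R. support_proj d \<rho> = P}. \<forall>e>0.
        \<exists>B\<in>D P. \<forall>i<d. \<forall>j<d. cmod (B $$ (i, j) - A $$ (i, j)) < e)"
    by (elim exE) (rule that, elim allE)
  have D: "countable (D P)" "D P \<subseteq> {\<rho> \<in> R. support_proj d \<rho> = P}"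
    "A \<in> {\<rho> \<in> R. support_proj d \<rho> = P} \<Longrightarrow> 0 < e \<Longrightarrow>
      \<exists>B\<in>D P. \<forall>i<d. \<forall>j<d. cmod (B $$ (i, j) - A $$ (i, j)) < e" for P A e
    using D'[of P] by blast+
  define R' where "R' = (\<Union>P\<in>\<P>. D P)"
  have "\<exists>\<rho>'\<in>R'. D_max d \<rho>' \<rho> < ereal \<epsilon>" if \<rho>: "\<rho> \<in> R" and "0 < \<epsilon>" for \<rho> \<epsilon>
  proof -
    have pos: "pos_op d \<rho>" using dens[OF \<rho>] by (simp add: density_op_def)
    have P: "support_proj d \<rho> \<in> \<P>"
      using \<rho> support_proj_props(1)[OF pos_op_carrier[OF pos]] by (auto simp: \<P>_def)
    obtain \<delta> where \<delta>: "0 < \<delta>" "\<And>B. pos_op d B \<Longrightarrow> support_proj d B = support_proj d \<rho> \<Longrightarrow>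
      (\<And>i j. i < d \<Longrightarrow> j < d \<Longrightarrow> cmod (B $$ (i, j) - \<rho> $$ (i, j)) \<le> \<delta>) \<Longrightarrow>
      op_le d B (complex_of_real (1 + \<epsilon> / 2) \<cdot>\<^sub>m \<rho>)"
      using op_le_of_entries_close[OF pos, of "\<epsilon> / 2"] \<open>0 < \<epsilon>\<close> half_gt_zero by blast
    obtain B where B: "B \<in> D (support_proj d \<rho>)"
      "\<And>i j. i < d \<Longrightarrow> j < d \<Longrightarrow> cmod (B $$ (i, j) - \<rho> $$ (i, j)) < \<delta>"
      using D(3)[of \<rho> "support_proj d \<rho>", OF _ \<delta>(1)] \<rho> by blast
    have B': "B \<in> R" "support_proj d B = support_proj d \<rho>" using B(1) D(2) by auto
    then have "op_le d B (complex_of_real (1 + \<epsilon> / 2) \<cdot>\<^sub>m \<rho>)"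
      using B(2) dens by (intro \<delta>(2)) (auto simp: density_op_def less_imp_le)
    \<comment> \<open>\<open>D_max\<close> asks for an exponential factor. Since ln (1 + x) \<le> x,
      the choice of half of \<epsilon> leaves room for the strict inequality.\<close>
    moreover have "exp (ln (1 + \<epsilon> / 2)) = 1 + \<epsilon> / 2" using \<open>0 < \<epsilon>\<close> by simp
    ultimately have "D_max d B \<rho> \<le> ereal (ln (1 + \<epsilon> / 2))"
      unfolding D_max_def by (intro Inf_lower imageI) simp
    also have "\<dots> < ereal \<epsilon>"
      using ln_add_one_self_le_self[of "\<epsilon> / 2"] \<open>0 < \<epsilon>\<close> by simp
    finally show ?thesis using B(1) P by (auto simp: R'_def)
  qed
  moreover have "R' \<subseteq> R" using D(2) by (auto simp: R'_def)
  ultimately have "max_rel_entropy_dense d R' R"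
    by (simp add: max_rel_entropy_dense_def)
  moreover have "countable R'" using cnt D(1) by (simp add: R'_def \<P>_def)
  ultimately show ?thesis using that by blast
qed

subsection \<open>Tests and exponential rates\<close>

lemma is_testD:
  assumes "is_test d n T"
  shows "T \<in> carrier_mat (d ^ n) (d ^ n)" "pos_op (d ^ n) T" "pos_op (d ^ n) (1\<^sub>m (d ^ n) - T)"
proof -
  show T: "T \<in> carrier_mat (d ^ n) (d ^ n)" using assms by (simp add: is_test_def op_le_def)
  then have "T - 0\<^sub>m (d ^ n) (d ^ n) = T" by (intro eq_matI) auto
  then show "pos_op (d ^ n) T" "pos_op (d ^ n) (1\<^sub>m (d ^ n) - T)"
    using assms by (auto simp: is_test_def op_le_def)
qed

lemma is_testI:
  assumes "pos_op (d ^ n) T" "pos_op (d ^ n) (1\<^sub>m (d ^ n) - T)"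
  shows "is_test d n T"
proof -
  have T: "T \<in> carrier_mat (d ^ n) (d ^ n)" using assms(1) by (rule pos_op_carrier)
  then have "T - 0\<^sub>m (d ^ n) (d ^ n) = T" by (intro eq_matI) auto
  then show ?thesis using assms T by (simp add: is_test_def op_le_def)
qed

lemma accept_prob_sum:
  assumes "\<sigma> \<in> carrier_mat m m" "T \<in> carrier_mat m m"
  shows "accept_prob \<sigma> T = Re (\<Sum>i<m. \<Sum>j<m. \<sigma> $$ (i, j) * T $$ (j, i))"
  unfolding accept_prob_def mat_trace_mult[OF assms] ..

lemma accept_prob_nonneg: "pos_op m \<sigma> \<Longrightarrow> pos_op m T \<Longrightarrow> 0 \<le> accept_prob \<sigma> T"
  using mat_trace_mult_nonneg[of m \<sigma> T] by (simp add: accept_prob_def less_eq_complex_def)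

text \<open>The trace of \<open>\<sigma> * (1 - T)\<close> is non-negative and \<sigma> has trace 1.
  The bound is what makes the real supremum in \<open>beta_err\<close> meaningful.\<close>

lemma accept_prob_le_one:
  assumes \<sigma>: "density_op m \<sigma>" and T: "T \<in> carrier_mat m m" "pos_op m (1\<^sub>m m - T)"
  shows "accept_prob \<sigma> T \<le> 1"
proof -
  have pos: "pos_op m \<sigma>" and tr: "mat_trace \<sigma> = 1" using \<sigma> by (auto simp: density_op_def)
  note carrier = pos_op_carrier[OF pos]
  have "accept_prob \<sigma> (1\<^sub>m m - T) = Re (mat_trace (\<sigma> * (1\<^sub>m m - T)))"
    by (simp add: accept_prob_def)
  also have "\<sigma> * (1\<^sub>m m - T) = \<sigma> - \<sigma> * T"
    using mult_minus_distrib_mat[OF carrier one_carrier_mat T(1)] carrier by simp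
  also have "mat_trace \<dots> = mat_trace \<sigma> - mat_trace (\<sigma> * T)"
    using carrier T(1) by (simp add: mat_trace_def sum_subtractf)
  finally show ?thesis
    using accept_prob_nonneg[OF pos T(2)] tr by (simp add: accept_prob_def)
qed

lemma accept_prob_mono:
  assumes le: "op_le m \<sigma> (complex_of_real c \<cdot>\<^sub>m \<tau>)" and \<tau>: "\<tau> \<in> carrier_mat m m" and T: "pos_op m T"
  shows "accept_prob \<sigma> T \<le> c * accept_prob \<tau> T"
proof -
  have \<sigma>: "\<sigma> \<in> carrier_mat m m" and pos: "pos_op m (complex_of_real c \<cdot>\<^sub>m \<tau> - \<sigma>)"
    using le by (auto simp: op_le_def)
  have "accept_prob (complex_of_real c \<cdot>\<^sub>m \<tau> - \<sigma>) T
    = Re (\<Sum>i<m. \<Sum>j<m. complex_of_real c * (\<tau> $$ (i, j) * T $$ (j, i)) - \<sigma> $$ (i, j) * T $$ (j, i))"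
    using \<sigma> \<tau> pos_op_carrier[OF T]
    by (subst accept_prob_sum[of _ m])
      (auto simp: minus_carrier_mat algebra_simps intro!: arg_cong[where f = Re] sum.cong)
  also have "\<dots> = c * accept_prob \<tau> T - accept_prob \<sigma> T"
    unfolding accept_prob_sum[OF \<sigma> pos_op_carrier[OF T]] accept_prob_sum[OF \<tau> pos_op_carrier[OF T]]
    by (simp add: sum_subtractf sum_distrib_left[symmetric] del: Re_sum)
  finally show ?thesis using accept_prob_nonneg[OF pos T] by simp
qed

section \<open>Averages of tests\<close>

definition average_mat :: "nat \<Rightarrow> nat \<Rightarrow> (nat \<Rightarrow> complex mat) \<Rightarrow> complex mat" where
  "average_mat m n E = mat m m (\<lambda>x. (\<Sum>k<n. E k $$ x) / of_nat n)"

lemma pos_op_average_mat: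
  assumes "\<And>k. k < n \<Longrightarrow> pos_op m (E k)"
  shows "pos_op m (average_mat m n E)"
proof -
  have "quad_form m (\<lambda>i j. average_mat m n E $$ (i, j)) v
    = (\<Sum>i<m. \<Sum>j<m. \<Sum>k<n. E k $$ (i, j) * v j * cnj (v i)) * of_real (inverse (real n))" for v
    unfolding quad_form_def average_mat_def sum_distrib_right
    by (intro sum.cong refl) (simp add: sum_distrib_left sum_distrib_right sum_divide_distrib field_simps)
  also have "(\<Sum>i<m. \<Sum>j<m. \<Sum>k<n. E k $$ (i, j) * v j * cnj (v i))
    = (\<Sum>k<n. quad_form m (\<lambda>i j. E k $$ (i, j)) v)" for v
    unfolding quad_form_def by (rule sum_swap_innermost)
  finally have "quad_form m (\<lambda>i j. average_mat m n E $$ (i, j)) v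
    = (\<Sum>k<n. quad_form m (\<lambda>i j. E k $$ (i, j)) v) * of_real (inverse (real n))" for v .
  moreover have "0 \<le> (\<Sum>k<n. quad_form m (\<lambda>i j. E k $$ (i, j)) v)" for v
    using assms by (intro sum_nonneg) (simp add: pos_op_iff_quad_form)
  moreover have "0 \<le> complex_of_real (inverse (real n))" by (simp add: less_eq_complex_def)
  ultimately have "0 \<le> quad_form m (\<lambda>i j. average_mat m n E $$ (i, j)) v" for v
    by (simp only: mult_nonneg_nonneg)
  then show ?thesis by (simp add: pos_op_iff_quad_form average_mat_def)
qed

text \<open>The complement of the average is the average of the complements, which is where
  \<open>0 < n\<close> enters; both are then averages of positive operators.\<close>

lemma is_test_average_mat:
  assumes "0 < n" "\<And>k. k < n \<Longrightarrow> is_test d l (E k)"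
  shows "is_test d l (average_mat (d ^ l) n E)"
proof (rule is_testI)
  show "pos_op (d ^ l) (average_mat (d ^ l) n E)"
    using assms(2) by (intro pos_op_average_mat is_testD(2))
  have E: "E k \<in> carrier_mat (d ^ l) (d ^ l)" if "k < n" for k using assms(2)[OF that] by (rule is_testD(1))
  have "1\<^sub>m (d ^ l) - average_mat (d ^ l) n E = average_mat (d ^ l) n (\<lambda>k. 1\<^sub>m (d ^ l) - E k)"
  proof (rule eq_matI)
    fix i j assume "i < dim_row (average_mat (d ^ l) n (\<lambda>k. 1\<^sub>m (d ^ l) - E k))"
      "j < dim_col (average_mat (d ^ l) n (\<lambda>k. 1\<^sub>m (d ^ l) - E k))"
    then have ij: "i < d ^ l" "j < d ^ l" by (auto simp: average_mat_def)
    have "(\<Sum>k<n. (1\<^sub>m (d ^ l) - E k) $$ (i, j)) = (\<Sum>k<n. 1\<^sub>m (d ^ l) $$ (i, j) - E k $$ (i, j))"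
      using ij by (intro sum.cong refl) (simp add: carrier_matD[OF E])
    then show "(1\<^sub>m (d ^ l) - average_mat (d ^ l) n E) $$ (i, j)
      = average_mat (d ^ l) n (\<lambda>k. 1\<^sub>m (d ^ l) - E k) $$ (i, j)"
      using ij assms(1) by (simp add: average_mat_def sum_subtractf diff_divide_distrib)
  qed (auto simp: average_mat_def)
  moreover have "pos_op (d ^ l) \<dots>"
    using assms(2) by (intro pos_op_average_mat is_testD(3))
  ultimately show "pos_op (d ^ l) (1\<^sub>m (d ^ l) - average_mat (d ^ l) n E)" by simp
qed

lemma accept_prob_average_mat:
  assumes "\<sigma> \<in> carrier_mat m m" "\<And>k. k < n \<Longrightarrow> E k \<in> carrier_mat m m"
  shows "accept_prob \<sigma> (average_mat m n E) = (\<Sum>k<n. accept_prob \<sigma> (E k)) / real n"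
proof -
  have "accept_prob \<sigma> (average_mat m n E)
    = Re ((\<Sum>i<m. \<Sum>j<m. \<Sum>k<n. \<sigma> $$ (i, j) * E k $$ (j, i)) / of_nat n)"
    using assms(1) by (subst accept_prob_sum[of _ m])
      (auto simp: average_mat_def sum_divide_distrib sum_distrib_left intro!: arg_cong[where f = Re] sum.cong)
  also have "\<dots> = Re ((\<Sum>k<n. \<Sum>i<m. \<Sum>j<m. \<sigma> $$ (i, j) * E k $$ (j, i)) / of_nat n)"
    by (subst sum_swap_innermost) (rule refl)
  also have "\<dots> = (\<Sum>k<n. accept_prob \<sigma> (E k)) / real n"
    by (simp add: accept_prob_sum[OF assms(1) assms(2)] del: Re_sum) simp
  finally show ?thesis .
qed

section \<open>Comparison of exponential rates\<close>

text \<open>A factor \<open>c n\<close> between probabilities shifts the exponent by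
  \<open>ln (c n) / n\<close>. This is applied with \<open>c n = exp l ^ n\<close>, where the shift
  is \<open>l\<close>, and with \<open>c n = n\<close>, where it vanishes in the limit.\<close>

lemma limsup_exp_rate_le:
  assumes ev: "\<forall>\<^sub>F n in sequentially. 0 \<le> p n \<and> 0 \<le> q n \<and> 0 < c n \<and> q n \<le> c n * p n"
    and lim: "(\<lambda>n. ln (c n) / real n) \<longlonglongrightarrow> L"
  shows "limsup (exp_rate p) \<le> ereal L + limsup (exp_rate q)"
proof -
  have "\<forall>\<^sub>F n in sequentially. exp_rate p n \<le> ereal (ln (c n) / real n) + exp_rate q n"
    using ev eventually_gt_at_top[of 0]
  proof eventually_elim
    case (elim n)
    \<comment> \<open>If \<open>q n = 0\<close>, the right-hand side is infinite. Otherwise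
      \<open>p n\<close> is positive as well and logarithms can be taken.\<close>
    show ?case
    proof (cases "q n = 0")
      case True
      then show ?thesis using elim by (simp add: exp_rate_def neg_log_def)
    next
      case False
      then have "0 < c n * p n" using elim by linarith
      then have "0 < p n" using elim by (simp add: zero_less_mult_iff)
      have "ln (q n) \<le> ln (c n * p n)" using elim False by simp
      also have "\<dots> = ln (c n) + ln (p n)" using elim \<open>0 < p n\<close> by (simp add: ln_mult)
      finally have "- ln (p n) / real n \<le> (ln (c n) - ln (q n)) / real n"
        using elim by (intro divide_right_mono) auto
      then show ?thesis
        using False \<open>0 < p n\<close> elim by (simp add: exp_rate_def neg_log_def diff_divide_distrib)
    qed
  qed
  then have "limsup (exp_rate p) \<le> limsup (\<lambda>n. ereal (ln (c n) / real n) + exp_rate q n)"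
    by (rule Limsup_mono)
  also have "\<dots> = ereal L + limsup (exp_rate q)"
    using lim by (intro ereal_limsup_lim_add) auto
  finally show ?thesis .
qed

lemma exp_rate_ge_iff:
  assumes "0 \<le> p n" "0 < n"
  shows "ereal r \<le> exp_rate p n \<longleftrightarrow> p n \<le> exp (- (real n * r))"
proof (cases "p n = 0")
  case True
  then show ?thesis using assms by (simp add: exp_rate_def neg_log_def)
next
  case False
  then have "0 < p n" using assms by simp
  then have "p n \<le> exp (- (real n * r)) \<longleftrightarrow> ln (p n) \<le> - (real n * r)"
    by (metis exp_le_cancel_iff exp_ln)
  moreover have "ereal r \<le> exp_rate p n \<longleftrightarrow> r \<le> - ln (p n) / real n"
    using False assms by (simp add: exp_rate_def neg_log_def)
  ultimately show ?thesis using assms(2) by (auto simp: field_simps)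
qed

lemma accept_prob_le_beta_err:
  assumes "\<And>\<sigma>. \<sigma> \<in> S \<Longrightarrow> density_op (d ^ n) \<sigma>" "is_test d n T" "\<sigma> \<in> S"
  shows "accept_prob \<sigma> T \<le> beta_err S T"
  unfolding beta_err_def
proof (rule cSUP_upper)
  show "bdd_above ((\<lambda>\<sigma>. accept_prob \<sigma> T) ` S)"
    using accept_prob_le_one[OF assms(1) is_testD(1,3)[OF assms(2)]] by (intro bdd_aboveI[of _ 1]) auto
qed (rule assms(3))

lemma beta_err_nonneg:
  assumes "\<And>\<sigma>. \<sigma> \<in> S \<Longrightarrow> density_op (d ^ n) \<sigma>" "is_test d n T" "S \<noteq> {}"
  shows "0 \<le> beta_err S T"
proof -
  obtain \<sigma> where "\<sigma> \<in> S" using assms(3) by blast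
  then have "0 \<le> accept_prob \<sigma> T"
    using assms(1)[of \<sigma>] is_testD(2)[OF assms(2)]
    by (auto simp: density_op_def intro: accept_prob_nonneg)
  also have "\<dots> \<le> beta_err S T"
    using assms(1,2) \<open>\<sigma> \<in> S\<close> by (rule accept_prob_le_beta_err)
  finally show ?thesis .
qed

lemma success_rate_le_of_op_le:
  assumes pos: "pos_op d \<rho>'" "pos_op d \<rho>"
    and le: "op_le d \<rho>' (complex_of_real (exp l) \<cdot>\<^sub>m \<rho>)"
    and T: "\<And>n. 1 \<le> n \<Longrightarrow> is_test d n (T n)"
  shows "success_rate \<rho> T \<le> ereal l + success_rate \<rho>' T"
  unfolding success_rate_def
proof (rule limsup_exp_rate_le)
  have "0 \<le> accept_prob (tensor_pow \<rho> n) (T n) \<and> 0 \<le> accept_prob (tensor_pow \<rho>' n) (T n) \<and>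
      0 < exp l ^ n \<and>
      accept_prob (tensor_pow \<rho>' n) (T n) \<le> exp l ^ n * accept_prob (tensor_pow \<rho> n) (T n)"
    if "1 \<le> n" for n
  proof -
    note T' = is_testD(2)[OF T[OF that]]
    have "accept_prob (tensor_pow \<rho>' n) (T n) \<le> exp l ^ n * accept_prob (tensor_pow \<rho> n) (T n)"
      by (rule accept_prob_mono[OF op_le_tensor_pow[OF pos(1) le pos(2)] tensor_pow_carrier T'])
        (use pos_op_carrier[OF pos(2)] in auto)
    then show ?thesis
      using accept_prob_nonneg[OF pos_op_tensor_pow[OF pos(1)] T']
        accept_prob_nonneg[OF pos_op_tensor_pow[OF pos(2)] T'] by simp
  qed
  then show "\<forall>\<^sub>F n in sequentially. 0 \<le> accept_prob (tensor_pow \<rho> n) (T n) \<and>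
      0 \<le> accept_prob (tensor_pow \<rho>' n) (T n) \<and> 0 < exp l ^ n \<and>
      accept_prob (tensor_pow \<rho>' n) (T n) \<le> exp l ^ n * accept_prob (tensor_pow \<rho> n) (T n)"
    by (rule eventually_sequentiallyI)
  show "(\<lambda>n. ln (exp l ^ n) / real n) \<longlonglongrightarrow> l"
    \<comment> \<open>The quotient equals \<open>l\<close> from \<open>n = 1\<close> on; at
      \<open>n = 0\<close> division by zero gives 0.\<close>
    by (rule tendsto_eventually, rule eventually_sequentiallyI[of 1]) (simp add: ln_realpow)
qed

text \<open>A liminf of at least \<open>r'\<close> guarantees only smaller rates at finite stages;
  the gap \<open>r < r'\<close> turns it into a bound valid for all large \<open>n\<close>, with a
  threshold depending on \<open>T\<close>.\<close>

lemma admissible_tests_eventually: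
  assumes S: "\<And>n. 1 \<le> n \<Longrightarrow> S n \<noteq> {}" "\<And>n \<sigma>. 1 \<le> n \<Longrightarrow> \<sigma> \<in> S n \<Longrightarrow> density_op (d ^ n) \<sigma>"
    and T: "T \<in> admissible_tests d S r'" and "r < r'"
  shows "\<exists>N. \<forall>n\<ge>N. beta_err (S n) (T n) \<le> exp (- (real n * r))"
proof -
  have "ereal r < liminf (exp_rate (\<lambda>n. beta_err (S n) (T n)))"
  proof (rule less_le_trans)
    show "ereal r < ereal r'" using \<open>r < r'\<close> by simp
    show "ereal r' \<le> liminf (exp_rate (\<lambda>n. beta_err (S n) (T n)))"
      using T by (simp add: admissible_tests_def)
  qed
  then have "\<forall>\<^sub>F n in sequentially. ereal r < exp_rate (\<lambda>n. beta_err (S n) (T n)) n"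
    by (rule less_LiminfD)
  then have "\<forall>\<^sub>F n in sequentially. beta_err (S n) (T n) \<le> exp (- (real n * r))"
    using eventually_ge_at_top[of 1]
  proof eventually_elim
    case (elim n)
    have "0 \<le> beta_err (S n) (T n)"
      using S elim T by (intro beta_err_nonneg) (auto simp: admissible_tests_def)
    then show ?case
      using exp_rate_ge_iff[of "\<lambda>n. beta_err (S n) (T n)" n r] elim less_imp_le[of "ereal r"] by simp
  qed
  then show ?thesis by (simp add: eventually_sequentially)
qed

text \<open>
  The \<open>n\<close>-th test averages the first \<open>n\<close> sequences, omitting those that have not yet reached the
  rate \<open>r\<close>; the factor \<open>1 / n\<close> lost by the average is subexponential.
\<close>

lemma admissible_tests_combine:
  assumes S: "\<And>n. 1 \<le> n \<Longrightarrow> S n \<noteq> {}" "\<And>n \<sigma>. 1 \<le> n \<Longrightarrow> \<sigma> \<in> S n \<Longrightarrow> density_op (d ^ n) \<sigma>"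
    and T: "\<And>k :: nat. T k \<in> admissible_tests d S r'" and "r < r'"
  obtains W where "W \<in> admissible_tests d S r"
    "\<And>\<rho> k. pos_op d \<rho> \<Longrightarrow> success_rate \<rho> W \<le> success_rate \<rho> (T k)"
proof -
  have "\<forall>k. \<exists>N. \<forall>n\<ge>N. beta_err (S n) (T k n) \<le> exp (- (real n * r))"
    using admissible_tests_eventually[of S d, OF S T \<open>r < r'\<close>] by blast
  from choice[OF this] obtain N
    where N: "\<And>k n. N k \<le> n \<Longrightarrow> beta_err (S n) (T k n) \<le> exp (- (real n * r))" by blast
  \<comment> \<open>The thresholds \<open>N k\<close> need not be bounded in \<open>k\<close>. Below
    its threshold a sequence is replaced by the zero test, which never accepts and so adds nothing
    to the error.\<close>
  define E where "E k n = (if N k \<le> n then T k n else 0\<^sub>m (d ^ n) (d ^ n))" for k n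
  define W where "W n = average_mat (d ^ n) n (\<lambda>k. E k n)" for n
  have T_test: "is_test d n (T k n)" if "1 \<le> n" for k n
    using T[of k] that by (simp add: admissible_tests_def)
  have "is_test d n (0\<^sub>m (d ^ n) (d ^ n))" for n
  proof (rule is_testI)
    have "1\<^sub>m (d ^ n) - 0\<^sub>m (d ^ n) (d ^ n) = (1\<^sub>m (d ^ n) :: complex mat)" by (intro eq_matI) auto
    then show "pos_op (d ^ n) (1\<^sub>m (d ^ n) - 0\<^sub>m (d ^ n) (d ^ n))" by (simp add: pos_op_one)
  qed (rule pos_op_zero)
  then have E_test: "is_test d n (E k n)" if "1 \<le> n" for k n
    using T_test[OF that] by (simp add: E_def)
  have W_test: "is_test d n (W n)" if "1 \<le> n" for n
    unfolding W_def using that E_test[OF that] by (intro is_test_average_mat) auto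
  have acc: "accept_prob \<sigma> (W n) = (\<Sum>k<n. accept_prob \<sigma> (E k n)) / real n"
    if "1 \<le> n" "pos_op (d ^ n) \<sigma>" for \<sigma> n
    unfolding W_def by (rule accept_prob_average_mat[OF pos_op_carrier[OF that(2)] is_testD(1)[OF E_test[OF that(1)]]])
  \<comment> \<open>Owing to the zero tests every summand obeys the bound, so the average does so at
    each \<open>n \<ge> 1\<close> and not merely eventually.\<close>
  have beta: "beta_err (S n) (W n) \<le> exp (- (real n * r))" if "1 \<le> n" for n
    unfolding beta_err_def
  proof (rule cSUP_least)
    fix \<sigma> assume \<sigma>: "\<sigma> \<in> S n"
    have pos: "pos_op (d ^ n) \<sigma>" using S(2)[OF that \<sigma>] by (simp add: density_op_def)
    have "accept_prob \<sigma> (E k n) \<le> exp (- (real n * r))" for k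
    proof (cases "N k \<le> n")
      case True
      have "accept_prob \<sigma> (T k n) \<le> beta_err (S n) (T k n)"
        using S(2)[OF that] T_test[OF that] \<sigma> by (rule accept_prob_le_beta_err)
      then show ?thesis using N[OF True] True by (simp add: E_def)
    next
      case False
      then show ?thesis
        using pos_op_carrier[OF pos] by (simp add: E_def accept_prob_sum[of _ "d ^ n"])
    qed
    then have "(\<Sum>k<n. accept_prob \<sigma> (E k n)) \<le> real n * exp (- (real n * r))"
      using sum_bounded_above[of "{..<n}" "\<lambda>k. accept_prob \<sigma> (E k n)"] by simp
    then show "accept_prob \<sigma> (W n) \<le> exp (- (real n * r))"
      using that by (simp add: acc[OF that pos] divide_le_eq mult.commute)
  qed (use S(1) that in blast)
  have "ereal r \<le> exp_rate (\<lambda>n. beta_err (S n) (W n)) n" if "1 \<le> n" for n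
    using beta[OF that] beta_err_nonneg[OF S(2)[OF that] W_test[OF that] S(1)[OF that]] that
    by (subst exp_rate_ge_iff) auto
  then have "ereal r \<le> liminf (exp_rate (\<lambda>n. beta_err (S n) (W n)))"
    by (intro Liminf_bounded eventually_sequentiallyI)
  then have "W \<in> admissible_tests d S r"
    using W_test by (simp add: admissible_tests_def)
  moreover have "success_rate \<rho> W \<le> success_rate \<rho> (T k)" if \<rho>: "pos_op d \<rho>" for \<rho> k
  proof -
    have "success_rate \<rho> W \<le> ereal 0 + success_rate \<rho> (T k)"
      unfolding success_rate_def
    proof (rule limsup_exp_rate_le)
      have "0 \<le> accept_prob (tensor_pow \<rho> n) (W n) \<and> 0 \<le> accept_prob (tensor_pow \<rho> n) (T k n) \<and>
          0 < real n \<and>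
          accept_prob (tensor_pow \<rho> n) (T k n) \<le> real n * accept_prob (tensor_pow \<rho> n) (W n)"
        \<comment> \<open>\<open>Suc k \<le> n\<close> places \<open>k\<close> among the averaged
          indices and \<open>N k \<le> n\<close> makes its summand the genuine test; the remaining
          summands are non-negative.\<close>
        if n: "max (Suc k) (N k) \<le> n" for n
      proof -
        have n1: "1 \<le> n" using n by simp
        note pos = pos_op_tensor_pow[OF \<rho>, of n]
        have "accept_prob (tensor_pow \<rho> n) (T k n) = accept_prob (tensor_pow \<rho> n) (E k n)"
          using n by (simp add: E_def)
        also have "\<dots> \<le> (\<Sum>k<n. accept_prob (tensor_pow \<rho> n) (E k n))"
          using n accept_prob_nonneg[OF pos is_testD(2)[OF E_test[OF n1]]]
          by (intro member_le_sum[of k _ "\<lambda>k. accept_prob (tensor_pow \<rho> n) (E k n)"]) auto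
        also have "\<dots> = real n * accept_prob (tensor_pow \<rho> n) (W n)"
          using n1 by (simp add: acc[OF n1 pos])
        finally show ?thesis
          using n1 accept_prob_nonneg[OF pos is_testD(2)[OF W_test[OF n1]]]
            accept_prob_nonneg[OF pos is_testD(2)[OF T_test[OF n1]]] by simp
      qed
      then show "\<forall>\<^sub>F n in sequentially. 0 \<le> accept_prob (tensor_pow \<rho> n) (W n) \<and>
          0 \<le> accept_prob (tensor_pow \<rho> n) (T k n) \<and> 0 < real n \<and>
          accept_prob (tensor_pow \<rho> n) (T k n) \<le> real n * accept_prob (tensor_pow \<rho> n) (W n)"
        by (rule eventually_sequentiallyI)
      show "(\<lambda>n. ln (real n) / real n) \<longlonglongrightarrow> 0"
        using ln_x_over_x_tendsto_0 filterlim_real_sequentially by (rule filterlim_compose)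
    qed
    then show ?thesis by simp
  qed
  ultimately show ?thesis using that by blast
qed

section \<open>Passage from the dense set to the whole set of states\<close>

text \<open>Replacing \<rho> by a nearby member of \<open>R'\<close> costs less than \<epsilon> in
  the exponent for the same test sequence, and \<epsilon> is arbitrary.\<close>

lemma success_rate_le_of_max_rel_entropy_dense:
  assumes dense: "max_rel_entropy_dense d R' R"
    and dens: "\<And>\<rho>. \<rho> \<in> R \<Longrightarrow> density_op d \<rho>"
    and W: "\<And>n. 1 \<le> n \<Longrightarrow> is_test d n (W n)"
    and le: "\<And>\<rho>. \<rho> \<in> R' \<Longrightarrow> success_rate \<rho> W \<le> y"
    and \<rho>: "\<rho> \<in> R"
  shows "success_rate \<rho> W \<le> y"
proof (rule ereal_le_epsilon2)
  fix \<epsilon> :: real assume "0 < \<epsilon>"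
  then have "\<exists>\<rho>'\<in>R'. D_max d \<rho>' \<rho> < ereal \<epsilon>"
    using dense \<rho> by (simp add: max_rel_entropy_dense_def)
  moreover have "R' \<subseteq> R" using dense by (simp add: max_rel_entropy_dense_def)
  ultimately obtain \<rho>' where \<rho>': "\<rho>' \<in> R'" "\<rho>' \<in> R" "D_max d \<rho>' \<rho> < ereal \<epsilon>"
    by blast
  \<comment> \<open>The strict bound on the infimum yields an actual exponent below \<epsilon> for
    which the operator inequality holds.\<close>
  then obtain l where l: "l < \<epsilon>" "op_le d \<rho>' (complex_of_real (exp l) \<cdot>\<^sub>m \<rho>)"
    unfolding D_max_def by (auto simp: INF_less_iff)
  have "success_rate \<rho> W \<le> ereal l + success_rate \<rho>' W"
    using dens[OF \<rho>'(2)] dens[OF \<rho>] l(2) W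
    by (intro success_rate_le_of_op_le) (auto simp: density_op_def)
  also have "\<dots> \<le> ereal \<epsilon> + y" using l(1) le[OF \<rho>'(1)] by (intro add_mono) auto
  finally show "success_rate \<rho> W \<le> y + ereal \<epsilon>" by (simp add: add.commute)
qed

theorem corollaryV7:
  fixes d :: nat
    and R :: "complex mat set"
    and S :: "nat \<Rightarrow> complex mat set"
  assumes "R \<noteq> {}"
    and "\<forall>\<rho> \<in> R. density_op d \<rho>"
    and "countable {P. projection_op d P \<and> {\<rho> \<in> R. support_proj d \<rho> = P} \<noteq> {}}"
    and "\<forall>n \<ge> 1. S n \<noteq> {} \<and> (\<forall>\<sigma> \<in> S n. density_op (d ^ n) \<sigma>)"
  shows "\<exists>R'. countable R' \<and> max_rel_entropy_dense d R' R \<and>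
    (\<forall>r :: real. r > 0 \<longrightarrow>
      (INF r' \<in> {r<..}. SUP \<rho> \<in> R'. sc d S r' \<rho>) \<ge> sc0 d S r R \<and>
      sc0 d S r R \<ge> (SUP \<rho> \<in> R. sc d S r \<rho>))"
proof -
  have dens: "\<And>\<rho>. \<rho> \<in> R \<Longrightarrow> density_op d \<rho>" using assms(2) by blast
  have S: "\<And>n. 1 \<le> n \<Longrightarrow> S n \<noteq> {}" "\<And>n \<sigma>. 1 \<le> n \<Longrightarrow> \<sigma> \<in> S n \<Longrightarrow> density_op (d ^ n) \<sigma>"
    using assms(4) by auto
  obtain R' where R': "countable R'" and dense: "max_rel_entropy_dense d R' R"
    using countable_max_rel_entropy_dense_subset[OF dens assms(3)] .
  have "R' \<subseteq> R" using dense by (simp add: max_rel_entropy_dense_def)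
  obtain \<rho>\<^sub>0 where "\<rho>\<^sub>0 \<in> R" using assms(1) by blast
  then have "\<exists>\<rho>'\<in>R'. D_max d \<rho>' \<rho>\<^sub>0 < ereal 1"
    using dense by (simp add: max_rel_entropy_dense_def)
  \<comment> \<open>Needed for the enumeration of \<open>R'\<close> below; it comes from density at
    a single state, with 1 as an arbitrary choice of \<epsilon>.\<close>
  then have "R' \<noteq> {}" by blast
  have "sc0 d S r R \<le> (SUP \<rho> \<in> R'. sc d S r' \<rho>)" if less: "r < r'" for r r'
  proof (rule dense_ge)
    fix y assume y: "(SUP \<rho> \<in> R'. sc d S r' \<rho>) < y"
    \<comment> \<open>The enumeration may repeat members, so finite and infinite \<open>R'\<close>
      are treated alike.\<close>
    define \<rho> where "\<rho> = from_nat_into R'"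
    have \<rho>: "\<rho> k \<in> R'" for k using \<open>R' \<noteq> {}\<close> by (simp add: \<rho>_def from_nat_into)
    \<comment> \<open>As \<open>y\<close> lies strictly above the supremum, it lies strictly above
      each infimum, so a test sequence beating \<open>y\<close> exists even where the infimum is not
      attained.\<close>
    have "\<forall>k. \<exists>T. T \<in> admissible_tests d S r' \<and> success_rate (\<rho> k) T < y"
    proof
      fix k
      have "sc d S r' (\<rho> k) < y" using SUP_upper[OF \<rho>[of k]] y by (rule le_less_trans)
      then show "\<exists>T. T \<in> admissible_tests d S r' \<and> success_rate (\<rho> k) T < y"
        unfolding sc_def by (auto simp: INF_less_iff)
    qed
    from choice[OF this] obtain T where T: "\<And>k. T k \<in> admissible_tests d S r'"
      "\<And>k. success_rate (\<rho> k) (T k) < y" by blast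
    obtain W where W: "W \<in> admissible_tests d S r"
      "\<And>\<rho> k. pos_op d \<rho> \<Longrightarrow> success_rate \<rho> W \<le> success_rate \<rho> (T k)"
      using admissible_tests_combine[of S d T, OF S T(1) less] by blast
    have W_test: "\<And>n. 1 \<le> n \<Longrightarrow> is_test d n (W n)"
      using W(1) by (simp add: admissible_tests_def)
    have "success_rate \<tau> W \<le> y" if \<tau>: "\<tau> \<in> R'" for \<tau>
    proof -
      obtain k where k: "\<tau> = \<rho> k"
        using from_nat_into_surj[OF R' \<tau>] unfolding \<rho>_def by metis
      have "pos_op d \<tau>" using dens \<tau> \<open>R' \<subseteq> R\<close> by (auto simp: density_op_def)
      then have "success_rate \<tau> W \<le> success_rate \<tau> (T k)" by (rule W(2))
      then show ?thesis using T(2)[of k] k by simp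
    qed
    from success_rate_le_of_max_rel_entropy_dense[OF dense dens W_test this]
    have "(SUP \<rho> \<in> R. success_rate \<rho> W) \<le> y" by (rule SUP_least)
    moreover have "sc0 d S r R \<le> (SUP \<rho> \<in> R. success_rate \<rho> W)"
      unfolding sc0_def using W(1) by (rule INF_lower)
    ultimately show "sc0 d S r R \<le> y" by simp
  qed
  \<comment> \<open>The general inequality sup inf \<le> inf sup: a sequence used for all of
    \<open>R\<close> also competes in the infimum for each single state.\<close>
  moreover have "(SUP \<rho> \<in> R. sc d S r \<rho>) \<le> sc0 d S r R" for r
    unfolding sc0_def
  proof (intro SUP_least INF_greatest)
    fix \<rho> T assume "\<rho> \<in> R" "T \<in> admissible_tests d S r"
    have "sc d S r \<rho> \<le> success_rate \<rho> T"
      unfolding sc_def using \<open>T \<in> _\<close> by (rule INF_lower)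
    also have "\<dots> \<le> (SUP \<rho> \<in> R. success_rate \<rho> T)"
      using \<open>\<rho> \<in> R\<close> by (rule SUP_upper)
    finally show "sc d S r \<rho> \<le> (SUP \<rho> \<in> R. success_rate \<rho> T)" .
  qed
  ultimately show ?thesis
    using R' dense by (intro exI[of _ R'] conjI allI impI INF_greatest) simp_all
qed

end
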